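(* Let $S$ be a simplicial surface without boundary in $\mathbb{R}^3$, let $v$ be a vertex of $S$, and let $W(v)$ be the local discrete Willmore energy of $S$ at $v$. Then $$W(v)\ge 0,$$ and $W(v)=0$ if and only if the star $S(v)$ is convex and all its vertices lie on a common sphere.
   Context: A simplicial surface $S$ in $\mathbb{R}^3$ has vertex set $V$, edge set $E$ and (triangular) face set $F$. Each edge $e$ is incident to two triangles. A consistent orientation of the two triangles induces an orientation of their circumcircles; $\beta(e)\in[0,\pi]$ denotes the external intersection angle of the circumcircles of the two triangles sharing $e$, i.e. the angle between the tangent vectors of the oriented circumcircles at either intersection point. The local discrete Willmore energy (also called conformal energy) at $v$ is $$W(v)=\sum_{e\ni v}\beta(e)-2\pi,$$ the sum being over all edges incident to $v$. The star $S(v)$ of $v$ is the subcomplex of $S$ consisting of the triangles incident with $v$; its vertices are $v$ and all neighbors of $v$. $S(v)$ is called convex if for each of its faces $f$ the star $S(v)$ lies to one side of the plane of $f$. The setting is that of Möbius geometry, where planes and straight lines are treated as infinite spheres and circles.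
   Formalization: As written the claim fails for flat stars (a non-Delaunay flat star is convex and lies in a plane, yet W(v)>0); so for stars with all vertices in one plane, convex also requires the vertices to lie on one side of each face's circumcircle. S is taken to be embedded; planes count as spheres. *)

theory Defs
  imports "HOL-Analysis.Analysis"
begin

section \<open>Simplicial surfaces in three-space\<close>

text \<open>
  A pure two-dimensional complex is given by its triangles, and a triangle by the set of its three
  vertices; the closed triangle is the convex hull. Unlike \<^const>\<open>simplicial_complex\<close>,
  the definition does not require finiteness, so that non-compact surfaces are included.
\<close>

definition vertices :: "'a set set \<Rightarrow> 'a set" where
  "vertices F = \<Union>F"

definition edges :: "'a set set \<Rightarrow> 'a set set" where
  "edges F = {e. card e = 2 \<and> (\<exists>f\<in>F. e \<subseteq> f)}"

definition star :: "'a set set \<Rightarrow> 'a \<Rightarrow> 'a set set" where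
  "star F v = {f \<in> F. v \<in> f}"

text \<open>
  The link of \<open>v\<close> is a cycle: the triangles at \<open>v\<close> are
  \<open>v u\<^sub>0 u\<^sub>1, v u\<^sub>1 u\<^sub>2, \<dots>, v u\<^sub>n\<^sub>-\<^sub>1 u\<^sub>0\<close>. For all vertices this says that the complex is a
  surface without boundary; in particular each edge lies in exactly two triangles.
\<close>

definition cyclic_link :: "'a set set \<Rightarrow> 'a \<Rightarrow> bool" where
  "cyclic_link F v \<longleftrightarrow>
     (\<exists>(n::nat) u. 3 \<le> n \<and> inj_on u {..<n} \<and> v \<notin> u ` {..<n} \<and>
        star F v = (\<lambda>i. {v, u i, u (Suc i mod n)}) ` {..<n})"

definition simplicial_surface :: "(real^3) set set \<Rightarrow> bool" where
  "simplicial_surface F \<longleftrightarrow>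
     (\<forall>f\<in>F. card f = 3 \<and> \<not> affine_dependent f) \<and>
     (\<forall>f\<in>F. \<forall>g\<in>F. convex hull f \<inter> convex hull g = convex hull (f \<inter> g)) \<and>
     (\<forall>v\<in>vertices F. cyclic_link F v)"


section \<open>Circumcircles and the discrete Willmore energy\<close>

definition circumcenter :: "'a::euclidean_space set \<Rightarrow> 'a" where
  "circumcenter f = (THE c. c \<in> affine hull f \<and> (\<exists>\<rho>. \<forall>x\<in>f. dist c x = \<rho>))"

definition circumradius :: "'a::euclidean_space set \<Rightarrow> real" where
  "circumradius f = (THE \<rho>. \<forall>x\<in>f. dist (circumcenter f) x = \<rho>)"

text \<open>
  Tangent vector at \<open>p\<close> of the circumcircle of \<open>p, q, r\<close>, traversed in the order
  \<open>p \<rightarrow> q \<rightarrow> r\<close>, i.e. counterclockwise about the normal \<open>cross3 (q - p) (r - p)\<close>.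
\<close>

definition circle_tangent :: "real^3 \<Rightarrow> real^3 \<Rightarrow> real^3 \<Rightarrow> real^3" where
  "circle_tangent p q r = cross3 (cross3 (q - p) (r - p)) (p - circumcenter {p, q, r})"

definition vec_angle :: "'a::real_inner \<Rightarrow> 'a \<Rightarrow> real" where
  "vec_angle x y = arccos (x \<bullet> y / (norm x * norm y))"

text \<open>
  The triangles \<open>p q a\<close> and \<open>p b q\<close> traverse the common edge \<open>p q\<close> in opposite directions, that
  is, they are consistently oriented. The angle depends neither on which end point of the edge is
  called \<open>p\<close>, nor on which of the two orientations is taken (exchange of \<open>a\<close> and \<open>b\<close>).
\<close>

definition beta :: "(real^3) set set \<Rightarrow> (real^3) set \<Rightarrow> real" where
  "beta F e = (THE t. \<exists>p q a b. e = {p, q} \<and> a \<noteq> b \<and> {p, q, a} \<in> F \<and> {p, q, b} \<in> F \<and>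
                 t = vec_angle (circle_tangent p q a) (circle_tangent p b q))"

definition willmore :: "(real^3) set set \<Rightarrow> real^3 \<Rightarrow> real" where
  "willmore F v = (\<Sum>e\<in>{e \<in> edges F. v \<in> e}. beta F e) - 2 * pi"


section \<open>Common spheres and convexity of the star\<close>

text \<open>Spheres of Moebius geometry: planes are spheres through infinity.\<close>

definition moebius_sphere :: "'a::euclidean_space set \<Rightarrow> bool" where
  "moebius_sphere \<Sigma> \<longleftrightarrow>
     (\<exists>c \<rho>. 0 < \<rho> \<and> \<Sigma> = sphere c \<rho>) \<or> (\<exists>a b. a \<noteq> 0 \<and> \<Sigma> = {x. a \<bullet> x = b})"

definition cospherical :: "'a::euclidean_space set \<Rightarrow> bool" where
  "cospherical X \<longleftrightarrow> (\<exists>\<Sigma>. moebius_sphere \<Sigma> \<and> X \<subseteq> \<Sigma>)"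

definition one_side_of_plane :: "'a::euclidean_space set \<Rightarrow> 'a set \<Rightarrow> bool" where
  "one_side_of_plane f X \<longleftrightarrow>
     (\<exists>a b. a \<noteq> 0 \<and> affine hull f = {x. a \<bullet> x = b} \<and> X \<subseteq> {x. a \<bullet> x \<le> b})"

definition one_side_of_circumcircle :: "'a::euclidean_space set \<Rightarrow> 'a set \<Rightarrow> bool" where
  "one_side_of_circumcircle f X \<longleftrightarrow>
     (\<forall>x\<in>X. circumradius f \<le> dist (circumcenter f) x) \<or>
     (\<forall>x\<in>X. dist (circumcenter f) x \<le> circumradius f)"

text \<open>
  The star is convex if it lies to one side of the plane of each of its faces. If the vertices of
  the star lie on a finite sphere, then the plane of a face \<open>f\<close> cuts that sphere in the
  circumcircle of \<open>f\<close>, and the condition says that on the sphere all vertices lie to one side of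
  this circle. If the star is flat, the sphere carrying its vertices is the plane itself; the plane
  of \<open>f\<close> then no longer separates anything, and only the second form of the condition, with the
  circumcircle of \<open>f\<close> in the plane, is meaningful and invariant under Moebius transformations.
  Without that clause a flat star would always be convex with vertices on a common sphere,
  although its energy vanishes only if it is Delaunay.
\<close>

definition star_convex :: "(real^3) set set \<Rightarrow> real^3 \<Rightarrow> bool" where
  "star_convex F v \<longleftrightarrow>
     (\<forall>f\<in>star F v. one_side_of_plane f (\<Union>g\<in>star F v. convex hull g)) \<and>
     (coplanar (\<Union>(star F v)) \<longrightarrow>
        (\<forall>f\<in>star F v. one_side_of_circumcircle f (\<Union>(star F v))))"

end

theory Submission
  imports Defs "HOL-Number_Theory.Cong"
begin

text \<open>
  Invert the star in a sphere centred at \<open>v\<close>. The circumcircles of the triangles at \<open>v\<close> become the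
  edge lines of a closed space polygon \<open>w\<close>, whose vertices are the images of the neighbours of
  \<open>v\<close>, and the angle \<open>\<beta>\<close> of an edge at \<open>v\<close> is the exterior angle of \<open>w\<close> at the corresponding
  vertex. Thus \<open>W(v) + 2\<pi>\<close> is the total curvature of \<open>w\<close>, and the inequality is Fenchel's theorem
  for polygons. It follows by splitting \<open>w\<close> into the fan of triangles with apex \<open>w 0\<close> and
  applying the triangle inequality for angles at every vertex.

  In the case of equality all these triangle inequalities are equalities, for every choice of the
  apex; hence \<open>w\<close> is planar and each edge line supports it. Conversely, a planar polygon with
  supporting edge lines attains equality, provided that no vertex lies on a foreign edge; the latter
  is what the embeddedness of the star gives. Planes containing \<open>w\<close> correspond to
  spheres carrying the vertices of the star, and supporting edge lines to the convexity of the star.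
\<close>

section \<open>Angles between vectors\<close>

lemma cos_vec_angle: "cos (vec_angle x y) = x \<bullet> y / (norm x * norm y)"
  and vec_angle_nonneg: "0 \<le> vec_angle x y"
  and vec_angle_le_pi: "vec_angle x y \<le> pi"
proof -
  have "\<bar>x \<bullet> y / (norm x * norm y)\<bar> \<le> 1"
    \<comment> \<open>With a zero vector the quotient is 0, so the angle is pi / 2 by default; the
      bounds survive this.\<close>
    using Cauchy_Schwarz_ineq2[of x y] by (cases "x = 0 \<or> y = 0") (auto simp: abs_mult)
  then have "- 1 \<le> x \<bullet> y / (norm x * norm y)" "x \<bullet> y / (norm x * norm y) \<le> 1"
    by linarith+
  then show "cos (vec_angle x y) = x \<bullet> y / (norm x * norm y)" "0 \<le> vec_angle x y"
    "vec_angle x y \<le> pi"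
    unfolding vec_angle_def by (simp_all add: arccos_lbound arccos_ubound)
qed

lemma vec_angle_eqI:
  "x \<bullet> y / (norm x * norm y) = x' \<bullet> y' / (norm x' * norm y') \<Longrightarrow> vec_angle x y = vec_angle x' y'"
  by (simp add: vec_angle_def)

lemma vec_angle_commute: "vec_angle x y = vec_angle y x"
  by (simp add: vec_angle_def inner_commute mult.commute)

lemma vec_angle_scaleR [simp]:
  assumes "c > 0"
  shows "vec_angle (c *\<^sub>R x) y = vec_angle x y" "vec_angle x (c *\<^sub>R y) = vec_angle x y"
  using assms by (auto intro!: vec_angle_eqI)

lemma vec_angle_minus_right: "vec_angle x (- y) = pi - vec_angle x y"
proof (rule cos_inj_pi)
  show "cos (vec_angle x (- y)) = cos (pi - vec_angle x y)"
    by (simp add: cos_vec_angle)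
qed (use vec_angle_nonneg[of x "- y"] vec_angle_le_pi[of x "- y"]
      vec_angle_nonneg[of x y] vec_angle_le_pi[of x y] in auto)

lemma vec_angle_minus_left: "vec_angle (- x) y = pi - vec_angle x y"
  by (metis vec_angle_commute vec_angle_minus_right)

lemma vec_angle_self [simp]: "x \<noteq> 0 \<Longrightarrow> vec_angle x x = 0"
  by (simp add: vec_angle_def dot_square_norm power2_eq_square)

lemma vec_angle_sgn: "vec_angle (sgn x) (sgn y) = vec_angle x y"
proof (cases "x = 0 \<or> y = 0")
  case False
  then have "sgn x \<bullet> sgn y / (norm (sgn x) * norm (sgn y)) = x \<bullet> y / (norm x * norm y)"
    by (simp add: norm_sgn) (simp add: sgn_div_norm divide_inverse mult_ac)
  then show ?thesis
    by (rule vec_angle_eqI)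
qed (auto simp: vec_angle_def)

section \<open>The triangle inequality for angles and its equality case\<close>

lemma vec_angle_unit:
  assumes "norm a = 1" "norm b = 1"
  shows "cos (vec_angle a b) = a \<bullet> b"
    and "sin (vec_angle a b) = norm (a - (a \<bullet> b) *\<^sub>R b)"
proof -
  show c: "cos (vec_angle a b) = a \<bullet> b"
    using assms by (simp add: cos_vec_angle)
  have unit: "a \<bullet> a = 1" "b \<bullet> b = 1"
    using assms by (simp_all add: dot_square_norm)
  have "(norm (a - (a \<bullet> b) *\<^sub>R b))\<^sup>2 = (a - (a \<bullet> b) *\<^sub>R b) \<bullet> (a - (a \<bullet> b) *\<^sub>R b)"
    by (rule power2_norm_eq_inner)
  also have "\<dots> = a \<bullet> a - 2 * (a \<bullet> b)\<^sup>2 + (a \<bullet> b)\<^sup>2 * (b \<bullet> b)"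
    by (simp add: inner_diff inner_commute[of b a] power2_eq_square algebra_simps)
  also have "\<dots> = 1 - (a \<bullet> b)\<^sup>2"
    using unit by simp
  also have "\<dots> = (sin (vec_angle a b))\<^sup>2"
    by (simp add: sin_squared_eq c)
  finally have "(sin (vec_angle a b))\<^sup>2 = (norm (a - (a \<bullet> b) *\<^sub>R b))\<^sup>2"
    by (rule sym)
  then show "sin (vec_angle a b) = norm (a - (a \<bullet> b) *\<^sub>R b)"
    by (rule power2_eq_imp_eq) (simp_all add: sin_ge_zero vec_angle_nonneg vec_angle_le_pi)
qed

text \<open>\<open>p\<close> and \<open>q\<close> are the components of \<open>a\<close> and
  \<open>c\<close> orthogonal to \<open>b\<close>, and their lengths are the two sines. The addition
  formula thus differs from \<open>a \<bullet> c\<close> by the nonnegative Cauchy-Schwarz term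
  \<open>p \<bullet> q + norm p * norm q\<close>, which controls both the triangle inequality and
  its equality case.\<close>

lemma cos_add_vec_angle:
  assumes "norm a = 1" "norm b = 1" "norm c = 1"
  defines "p \<equiv> a - (a \<bullet> b) *\<^sub>R b" and "q \<equiv> c - (c \<bullet> b) *\<^sub>R b"
  shows "cos (vec_angle a b + vec_angle b c) = a \<bullet> c - (p \<bullet> q + norm p * norm q)"
proof -
  have "b \<bullet> b = 1"
    using assms by (simp add: dot_square_norm)
  moreover have "p \<bullet> q = a \<bullet> c - (a \<bullet> b) * (c \<bullet> b) - (a \<bullet> b) * (c \<bullet> b)
      + (a \<bullet> b) * (c \<bullet> b) * (b \<bullet> b)"
    unfolding p_def q_def inner_diff_left inner_diff_right inner_scaleR_left inner_scaleR_right
      inner_commute[of b c] by (simp add: algebra_simps)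
  ultimately have pq: "p \<bullet> q = a \<bullet> c - (a \<bullet> b) * (c \<bullet> b)"
    by simp
  have "cos (vec_angle a b) = a \<bullet> b" "sin (vec_angle a b) = norm p"
    "cos (vec_angle b c) = c \<bullet> b" "sin (vec_angle b c) = norm q"
    using vec_angle_unit[OF assms(1,2)] vec_angle_unit[OF assms(3,2)] vec_angle_commute[of b c]
    by (simp_all only: p_def q_def)
  then show ?thesis
    by (simp only: cos_add pq)
qed

lemma vec_angle_triangle_unit:
  assumes "norm a = 1" "norm b = 1" "norm c = 1"
  shows "vec_angle a c \<le> vec_angle a b + vec_angle b c"
proof (cases "vec_angle a b + vec_angle b c \<le> pi")
  case True
  have "cos (vec_angle a b + vec_angle b c) \<le> cos (vec_angle a c)"
    unfolding cos_add_vec_angle[OF assms] vec_angle_unit(1)[OF assms(1,3)]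
    using Cauchy_Schwarz_ineq2[of "a - (a \<bullet> b) *\<^sub>R b" "c - (c \<bullet> b) *\<^sub>R b"] by linarith
  then show ?thesis
    using True cos_mono_le_eq[of "vec_angle a b + vec_angle b c" "vec_angle a c"]
      vec_angle_nonneg[of a b] vec_angle_nonneg[of b c] vec_angle_nonneg[of a c] vec_angle_le_pi[of a c]
    by simp
next
  case False
  then show ?thesis
    using vec_angle_le_pi[of a c] by linarith
qed

lemma vec_angle_triangle:
  assumes "x \<noteq> 0" "y \<noteq> 0" "z \<noteq> 0"
  shows "vec_angle x z \<le> vec_angle x y + vec_angle y z"
  using vec_angle_triangle_unit[of "sgn x" "sgn y" "sgn z", unfolded vec_angle_sgn] assms
  by (simp only: norm_sgn if_False)

lemma vec_angle_eq_piD: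
  assumes "x \<noteq> 0" "y \<noteq> 0" "vec_angle x y = pi"
  obtains k where "k > 0" "y = - (k *\<^sub>R x)"
proof -
  have "x \<bullet> y = - (norm x * norm y)"
    using cos_vec_angle[of x y] assms by (simp add: field_simps)
  then have "norm x *\<^sub>R (- y) = norm y *\<^sub>R x"
    using norm_cauchy_schwarz_eq[of x "- y"] by simp
  then have "(1 / norm x) *\<^sub>R (norm x *\<^sub>R (- y)) = (1 / norm x) *\<^sub>R (norm y *\<^sub>R x)"
    by (simp only:)
  then have "- y = (norm y / norm x) *\<^sub>R x"
    using assms by simp
  then have "y = - ((norm y / norm x) *\<^sub>R x)"
    by (metis minus_minus)
  then show ?thesis
    using that[of "norm y / norm x"] assms by simp
qed

lemma vec_angle_minus_scaleR: "x \<noteq> 0 \<Longrightarrow> k > 0 \<Longrightarrow> vec_angle x (- (k *\<^sub>R x)) = pi"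
  by (simp add: vec_angle_minus_right)

text \<open>Equality in the Cauchy--Schwarz inequality makes the components of the outer vectors orthogonal
  to the middle one antiparallel.\<close>

lemma vec_angle_triangle_eqD:
  assumes "x \<noteq> 0" "y \<noteq> 0" "z \<noteq> 0" and eq: "vec_angle x y + vec_angle y z = vec_angle x z"
    and not_pi: "vec_angle x z \<noteq> pi"
  obtains \<alpha> \<gamma> where "\<alpha> \<ge> 0" "\<gamma> \<ge> 0" "y = \<alpha> *\<^sub>R x + \<gamma> *\<^sub>R z"
proof -
  define a b c where "a = sgn x" and "b = sgn y" and "c = sgn z"
  have n: "norm a = 1" "norm b = 1" "norm c = 1"
    using assms by (simp_all add: a_def b_def c_def norm_sgn)
  have xyz: "x = norm x *\<^sub>R a" "y = norm y *\<^sub>R b" "z = norm z *\<^sub>R c"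
    using assms by (simp_all add: a_def b_def c_def sgn_div_norm)
  have eq': "vec_angle a b + vec_angle b c = vec_angle a c"
    using eq by (simp add: a_def b_def c_def vec_angle_sgn)
  define p q where "p = a - (a \<bullet> b) *\<^sub>R b" and "q = c - (c \<bullet> b) *\<^sub>R b"
  have "p \<bullet> q = - (norm p * norm q)"
    using cos_add_vec_angle[OF n] vec_angle_unit(1)[OF n(1,3)] eq' by (simp add: p_def q_def)
  then have "norm p *\<^sub>R (- q) = norm q *\<^sub>R p"
    using norm_cauchy_schwarz_eq[of p "- q"] by simp
  moreover have s: "norm p = sin (vec_angle a b)" "norm q = sin (vec_angle b c)"
    using vec_angle_unit(2)[OF n(1,2)] vec_angle_unit(2)[OF n(3,2)]
    by (simp_all add: p_def q_def vec_angle_commute)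
  \<comment> \<open>Inserting \<open>p\<close> and \<open>q\<close> into the antiparallel relation
    relates \<open>b\<close> to \<open>a\<close> and \<open>c\<close>; the coefficient of
    \<open>b\<close> is the sine of the total angle.\<close>
  ultimately have "norm q *\<^sub>R a + norm p *\<^sub>R c = (norm q * (a \<bullet> b) + norm p * (b \<bullet> c)) *\<^sub>R b"
    by (simp add: p_def q_def algebra_simps inner_commute)
  also have "norm q * (a \<bullet> b) + norm p * (b \<bullet> c) = sin (vec_angle a b + vec_angle b c)"
    using s vec_angle_unit(1)[OF n(1,2)] vec_angle_unit(1)[OF n(2,3)]
    by (simp add: sin_add mult.commute)
  finally have comb: "norm q *\<^sub>R a + norm p *\<^sub>R c = sin (vec_angle a c) *\<^sub>R b"
    by (simp add: eq')
  have ac: "vec_angle a c = vec_angle x z"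
    by (simp add: a_def c_def vec_angle_sgn)
  show ?thesis
  proof (cases "vec_angle x z = 0")
    case True
    then have "vec_angle a b = 0"
      using eq' ac vec_angle_nonneg[of a b] vec_angle_nonneg[of b c] by linarith
    then have "p = 0" "a \<bullet> b = 1"
      using s vec_angle_unit(1)[OF n(1,2)] by simp_all
    then have "b = a"
      by (simp add: p_def)
    then have "y = norm y *\<^sub>R a"
      using xyz(2) by metis
    also have "\<dots> = (norm y / norm x) *\<^sub>R x + 0 *\<^sub>R z"
      by (simp add: a_def sgn_div_norm divide_inverse)
    finally have "y = (norm y / norm x) *\<^sub>R x + 0 *\<^sub>R z" .
    then show ?thesis
      by (rule that[rotated 2]) auto
  next
    case False
    define s where "s = sin (vec_angle x z)"
    have "s > 0"
      unfolding s_def using False not_pi vec_angle_nonneg[of x z] vec_angle_le_pi[of x z]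
      by (intro sin_gt_zero) auto
    have "b = (1 / s) *\<^sub>R (norm q *\<^sub>R a + norm p *\<^sub>R c)"
      using \<open>s > 0\<close> comb by (simp add: ac s_def)
    then have "y = norm y *\<^sub>R ((1 / s) *\<^sub>R (norm q *\<^sub>R a + norm p *\<^sub>R c))"
      using xyz(2) by metis
    also have "\<dots> = (norm y * norm q / (s * norm x)) *\<^sub>R x + (norm y * norm p / (s * norm z)) *\<^sub>R z"
      by (simp add: a_def c_def sgn_div_norm scaleR_add_right divide_inverse mult_ac)
    finally have "y = (norm y * norm q / (s * norm x)) *\<^sub>R x + (norm y * norm p / (s * norm z)) *\<^sub>R z" .
    then show ?thesis
      using \<open>s > 0\<close> by (intro that[rotated 2]) auto
  qed
qed

text \<open>A vector in the cone of \<open>x\<close> and \<open>z\<close> splits their angle: the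
  cosines of both sides agree, and once the sum is known to be at most pi, cosine is injective
  there.\<close>

lemma vec_angle_add:
  assumes "x \<noteq> 0" "y \<noteq> 0" "z \<noteq> 0" and "\<alpha> \<ge> 0" "\<gamma> \<ge> 0" and y: "y = \<alpha> *\<^sub>R x + \<gamma> *\<^sub>R z"
  shows "vec_angle x y + vec_angle y z = vec_angle x z"
proof -
  define a b c where "a = sgn x" and "b = sgn y" and "c = sgn z"
  have n: "norm a = 1" "norm b = 1" "norm c = 1"
    using assms by (simp_all add: a_def b_def c_def norm_sgn)
  then have i: "a \<bullet> a = 1" "b \<bullet> b = 1" "c \<bullet> c = 1"
    by (simp_all add: dot_square_norm)
  define r t where "r = \<alpha> * norm x / norm y" and "t = \<gamma> * norm z / norm y"
  have rt: "r \<ge> 0" "t \<ge> 0"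
    using assms by (simp_all add: r_def t_def)
  have "r *\<^sub>R a = (\<alpha> / norm y) *\<^sub>R x" "t *\<^sub>R c = (\<gamma> / norm y) *\<^sub>R z"
    using assms(1,3) by (simp_all add: r_def t_def a_def c_def sgn_div_norm)
  then have "r *\<^sub>R a + t *\<^sub>R c = (1 / norm y) *\<^sub>R (\<alpha> *\<^sub>R x + \<gamma> *\<^sub>R z)"
    by (simp add: scaleR_add_right)
  then have b: "b = r *\<^sub>R a + t *\<^sub>R c"
    by (simp add: y [symmetric] b_def sgn_div_norm divide_inverse)
  define s where "s = a \<bullet> c"
  have "\<bar>s\<bar> \<le> 1"
    using Cauchy_Schwarz_ineq2[of a c] n by (simp add: s_def)
  have ab: "a \<bullet> b = r + t * s" and bc: "b \<bullet> c = r * s + t"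
    using i by (simp_all add: b s_def inner_add)
  have one: "r * r + t * t + 2 * (r * t * s) = 1"
    using i by (simp add: b s_def inner_add inner_commute algebra_simps)
  \<comment> \<open>The right-hand side is the supplement of the angle between \<open>c\<close> and
    \<open>b\<close>, so this bounds the sum by pi.\<close>
  have "vec_angle a b \<le> vec_angle (- c) b"
  proof -
    have "(- c) \<bullet> b \<le> a \<bullet> b"
    proof -
      have "0 \<le> (r + t) * (1 + s)"
        using rt \<open>\<bar>s\<bar> \<le> 1\<close> by simp
      then show ?thesis
        using ab bc by (simp add: inner_commute algebra_simps)
    qed
    then have "cos (vec_angle (- c) b) \<le> cos (vec_angle a b)"
      using n by (simp add: vec_angle_unit(1))
    then show ?thesis
      using cos_mono_le_eq[of "vec_angle (- c) b" "vec_angle a b"]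
      by (simp only: vec_angle_nonneg vec_angle_le_pi)
  qed
  then have le: "vec_angle a b + vec_angle b c \<le> pi"
    by (simp add: vec_angle_minus_left vec_angle_commute[of c b])
  define R where "R = sqrt (1 - s\<^sup>2)"
  have "sin (vec_angle a b) = t * R"
  proof -
    have "(sin (vec_angle a b))\<^sup>2 = 1 - (r + t * s)\<^sup>2"
      using n ab by (simp add: sin_squared_eq vec_angle_unit(1))
    also have "\<dots> = t\<^sup>2 * (1 - s\<^sup>2)"
      using one by (simp add: power2_eq_square algebra_simps)
    finally show ?thesis
      using vec_angle_nonneg[of a b] vec_angle_le_pi[of a b] \<open>t \<ge> 0\<close>
      unfolding R_def by (metis abs_of_nonneg real_sqrt_abs real_sqrt_mult sin_ge_zero)
  qed
  moreover have "sin (vec_angle b c) = r * R"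
  proof -
    have "(sin (vec_angle b c))\<^sup>2 = 1 - (r * s + t)\<^sup>2"
      using n bc by (simp add: sin_squared_eq vec_angle_unit(1))
    also have "\<dots> = r\<^sup>2 * (1 - s\<^sup>2)"
      using one by (simp add: power2_eq_square algebra_simps)
    finally show ?thesis
      using vec_angle_nonneg[of b c] vec_angle_le_pi[of b c] \<open>r \<ge> 0\<close>
      unfolding R_def by (metis abs_of_nonneg real_sqrt_abs real_sqrt_mult sin_ge_zero)
  qed
  moreover have "R * R = 1 - s * s"
  proof -
    have "s\<^sup>2 \<le> 1"
      using \<open>\<bar>s\<bar> \<le> 1\<close> by (simp add: abs_square_le_1)
    then show ?thesis
      by (simp add: R_def power2_eq_square)
  qed
  ultimately have "cos (vec_angle a b + vec_angle b c) = (r + t * s) * (r * s + t) - (t * R) * (r * R)"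
    and R: "R * R = 1 - s * s"
    using n ab bc by (simp_all only: cos_add vec_angle_unit(1))
  note this(1)
  also have "(t * R) * (r * R) = t * r * (R * R)"
    by (simp only: mult_ac)
  also note R
  also have "(r + t * s) * (r * s + t) - t * r * (1 - s * s) = s * (r * r + t * t + 2 * (r * t * s))"
    by (simp add: algebra_simps)
  also have "\<dots> = s"
    by (simp add: one)
  also have "\<dots> = cos (vec_angle a c)"
    using n by (simp add: s_def vec_angle_unit(1))
  finally have "cos (vec_angle a b + vec_angle b c) = cos (vec_angle a c)" .
  then have "vec_angle a b + vec_angle b c = vec_angle a c"
    by (rule cos_inj_pi[rotated 4])
      (simp_all add: le vec_angle_nonneg vec_angle_le_pi add_nonneg_nonneg)
  then show ?thesis
    by (simp add: a_def b_def c_def vec_angle_sgn)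
qed

text \<open>\<open>r - p\<close> is the sum of \<open>q - p\<close> and \<open>r - q\<close>, so it
  splits their angle. Collinear triples are covered, since triangles of a fan may be
  degenerate.\<close>

lemma triangle_angle_sum:
  assumes "p \<noteq> q" "q \<noteq> r" "r \<noteq> p"
  shows "vec_angle (q - p) (r - p) + vec_angle (p - q) (r - q) + vec_angle (q - r) (p - r) = pi"
proof -
  have "vec_angle (q - p) (r - p) + vec_angle (r - p) (r - q) = vec_angle (q - p) (r - q)"
    using assms by (intro vec_angle_add[where \<alpha> = 1 and \<gamma> = 1]) auto
  moreover have "vec_angle (q - r) (p - r) = vec_angle (r - p) (r - q)"
    using vec_angle_minus_left[of "r - q" "p - r"] vec_angle_minus_right[of "r - q" "r - p"]
    by (simp add: vec_angle_commute)
  moreover have "vec_angle (p - q) (r - q) = pi - vec_angle (q - p) (r - q)"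
    using vec_angle_minus_left[of "q - p" "r - q"] by simp
  ultimately show ?thesis
    by simp
qed

section \<open>Total curvature of closed polygons\<close>

definition total_curvature :: "nat \<Rightarrow> (nat \<Rightarrow> 'a::real_inner) \<Rightarrow> real" where
  "total_curvature n w = (\<Sum>i<n. vec_angle (w (Suc i) - w i) (w (Suc (Suc i)) - w (Suc i)))"

definition angle_excess :: "'a::real_inner \<Rightarrow> 'a \<Rightarrow> 'a \<Rightarrow> real" where
  "angle_excess x y z = vec_angle x y + vec_angle y z - vec_angle x z"

lemma angle_excess_nonneg: "x \<noteq> 0 \<Longrightarrow> y \<noteq> 0 \<Longrightarrow> z \<noteq> 0 \<Longrightarrow> 0 \<le> angle_excess x y z"
  using vec_angle_triangle[of x y z] by (simp add: angle_excess_def)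

lemma sum_angle_excess:
  "(\<Sum>i<m. angle_excess (x 0) (x i) (x (Suc i))) =
     vec_angle (x 0) (x 0) + (\<Sum>i<m. vec_angle (x i) (x (Suc i))) - vec_angle (x 0) (x m)"
  by (induction m) (simp_all add: angle_excess_def)

section \<open>Fenchel's inequality for closed polygons\<close>

lemma sum_periodic_shift:
  fixes f :: "nat \<Rightarrow> 'b::comm_monoid_add"
  assumes "\<And>i. f (i + n) = f i"
  shows "(\<Sum>i<n. f (i + k)) = (\<Sum>i<n. f i)"
proof (induction k)
  case (Suc k)
  have "(\<Sum>i<n. f (i + Suc k)) = (\<Sum>i<n. f (i + k))"
  proof (cases n)
    case (Suc m)
    have "f (Suc m + k) = f k"
      using assms[of k] Suc by (simp add: add.commute)
    then show ?thesis
      unfolding Suc sum.lessThan_Suc[of "\<lambda>i. f (i + Suc k)"] sum.lessThan_Suc_shift[of "\<lambda>i. f (i + k)"]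
      by (simp add: add.commute)
  qed simp
  then show ?case
    using Suc.IH by simp
qed simp

locale closed_polygon =
  fixes n :: nat and w :: "nat \<Rightarrow> 'a::real_inner"
  assumes n_ge_3: "3 \<le> n"
    and periodic: "w (i + n) = w i"
    and w_eq_iff: "w i = w j \<longleftrightarrow> i mod n = j mod n"
begin

lemma n_pos: "0 < n"
  using n_ge_3 by simp

lemma closed_polygon_shift: "closed_polygon n (\<lambda>i. w (i + k))"
proof
  show "w (i + k) = w (j + k) \<longleftrightarrow> i mod n = j mod n" for i j
    unfolding w_eq_iff by (simp flip: cong_def add: cong_add_rcancel_nat)
next
  show "w (i + n + k) = w (i + k)" for i
    using periodic[of "i + k"] by (simp add: ac_simps)
qed (rule n_ge_3)

lemma total_curvature_shift: "total_curvature n (\<lambda>i. w (i + k)) = total_curvature n w"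
  using sum_periodic_shift[of "\<lambda>i. vec_angle (w (Suc i) - w i) (w (Suc (Suc i)) - w (Suc i))" n k]
  periodic[of "Suc _"] periodic[of "Suc (Suc _)"] by (simp add: total_curvature_def periodic)

text \<open>The loss at \<open>w (Suc i)\<close> when the diagonal to the apex \<open>w 0\<close>
  splits the angle of the polygon there.\<close>

definition vertex_excess :: "nat \<Rightarrow> real" where
  "vertex_excess i = angle_excess (w i - w (Suc i)) (w 0 - w (Suc i)) (w (Suc (Suc i)) - w (Suc i))"

definition apex_excess :: "nat \<Rightarrow> real" where
  "apex_excess i = angle_excess (w 1 - w 0) (w (Suc i) - w 0) (w (Suc (Suc i)) - w 0)"

lemma w_neq: "i < n \<Longrightarrow> j < n \<Longrightarrow> i \<noteq> j \<Longrightarrow> w i \<noteq> w j"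
  by (simp add: w_eq_iff)

lemma w_Suc_neq: "w (Suc i) \<noteq> w i"
  using n_ge_3 by (auto simp: w_eq_iff mod_Suc)

text \<open>The fan of triangles with apex \<open>w 0\<close>: their angles add up to \<open>(n - 2) * pi\<close>, and by the
  triangle inequality for angles they dominate the angles of the polygon.\<close>

lemma total_curvature_fan:
  "total_curvature n w - 2 * pi = (\<Sum>i<n - 1. vertex_excess i) + (\<Sum>i<n - 2. apex_excess i)"
proof -
  obtain m where n: "n = Suc (Suc m)" and "m > 0"
    using n_ge_3 by (metis Suc_le_D numeral_3_eq_3 Suc_le_mono zero_less_Suc)
  \<comment> \<open>\<open>I i\<close> is the angle of the polygon at \<open>w (Suc i)\<close>. The
    triangle \<open>w 0\<close>, \<open>w (Suc i)\<close>, \<open>w (Suc (Suc i))\<close> of the fan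
    has the angles \<open>A i\<close>, \<open>B i\<close>, \<open>C (Suc i)\<close>, in this
    order.\<close>
  define I where "I i = vec_angle (w i - w (Suc i)) (w (Suc (Suc i)) - w (Suc i))" for i
  define A where "A i = vec_angle (w (Suc i) - w 0) (w (Suc (Suc i)) - w 0)" for i
  define B where "B i = vec_angle (w 0 - w (Suc i)) (w (Suc (Suc i)) - w (Suc i))" for i
  define C where "C i = vec_angle (w i - w (Suc i)) (w 0 - w (Suc i))" for i
  have w_n: "w n = w 0" "w (Suc n) = w 1"
    using periodic[of 0] periodic[of 1] by simp_all
  have "total_curvature n w = (\<Sum>i<n. pi - I i)"
    unfolding total_curvature_def I_def
    by (intro sum.cong refl) (metis minus_diff_eq vec_angle_minus_left)
  also have "\<dots> = n * pi - (\<Sum>i<Suc m. I i) - I (Suc m)"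
    by (simp add: sum_subtractf n)
  also have "I (Suc m) = vec_angle (w 1 - w 0) (w (Suc m) - w 0)"
    using w_n by (simp add: I_def n vec_angle_commute)
  finally have tc: "total_curvature n w =
    n * pi - (\<Sum>i<Suc m. I i) - vec_angle (w 1 - w 0) (w (Suc m) - w 0)" .
  have tri: "A i + B i + C (Suc i) = pi" if "i < m" for i
    using triangle_angle_sum[of "w 0" "w (Suc i)" "w (Suc (Suc i))"] that w_neq
    by (simp add: n A_def B_def C_def)
  \<comment> \<open>At \<open>w 1\<close> and at \<open>w (Suc m)\<close>, the last vertex before
    \<open>w n = w 0\<close>, the diagonal is itself an edge, so one of the two angles is 0.\<close>
  have "C 0 = 0" "B m = 0"
    using w_Suc_neq[of 0] w_Suc_neq[of "Suc m"] w_n by (simp_all add: B_def C_def n[symmetric])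
  then have "(\<Sum>i<Suc m. C i + B i) = (\<Sum>i<m. B i + C (Suc i))"
    unfolding sum.distrib sum.lessThan_Suc_shift[of C] sum.lessThan_Suc[of B] by simp
  also have "\<dots> = (\<Sum>i<m. pi - A i)"
    by (intro sum.cong refl) (use tri in \<open>auto simp: algebra_simps\<close>)
  also have "\<dots> = m * pi - (\<Sum>i<m. A i)"
    by (simp add: sum_subtractf)
  finally have CB: "(\<Sum>i<Suc m. C i + B i) = m * pi - (\<Sum>i<m. A i)" .
  have "(\<Sum>i<n - 1. vertex_excess i) = (\<Sum>i<Suc m. C i + B i) - (\<Sum>i<Suc m. I i)"
    unfolding sum_subtractf[symmetric] by (simp add: n vertex_excess_def angle_excess_def B_def C_def I_def)
  moreover have "(\<Sum>i<n - 2. apex_excess i) = (\<Sum>i<m. A i) - vec_angle (w 1 - w 0) (w (Suc m) - w 0)"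
    using sum_angle_excess[of "\<lambda>i. w (Suc i) - w 0" m] w_Suc_neq[of 0]
    by (simp add: n apex_excess_def A_def)
  ultimately show ?thesis
    unfolding tc CB by (simp add: n algebra_simps)
qed

lemma vertex_excess_nonneg: "i < n - 1 \<Longrightarrow> 0 \<le> vertex_excess i"
  unfolding vertex_excess_def
  by (intro angle_excess_nonneg) (use w_neq[of 0 "Suc i"] w_Suc_neq[of i] w_Suc_neq[of "Suc i"] in auto)

lemma apex_excess_nonneg: "i < n - 2 \<Longrightarrow> 0 \<le> apex_excess i"
  unfolding apex_excess_def
  by (intro angle_excess_nonneg) (use w_neq[of 0 "Suc i"] w_neq[of 0 "Suc (Suc i)"] w_Suc_neq[of 0] in \<open>auto simp: less_diff_conv\<close>)

theorem fenchel: "2 * pi \<le> total_curvature n w"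
proof -
  have "0 \<le> (\<Sum>i<n - 1. vertex_excess i) + (\<Sum>i<n - 2. apex_excess i)"
    by (intro add_nonneg_nonneg sum_nonneg vertex_excess_nonneg apex_excess_nonneg) auto
  then show ?thesis
    using total_curvature_fan by linarith
qed

lemma fenchel_eq_iff:
  "total_curvature n w = 2 * pi \<longleftrightarrow> (\<forall>i<n - 1. vertex_excess i = 0) \<and> (\<forall>i<n - 2. apex_excess i = 0)"
proof -
  have "total_curvature n w = 2 * pi \<longleftrightarrow>
      (\<Sum>i<n - 1. vertex_excess i) + (\<Sum>i<n - 2. apex_excess i) = 0"
    using total_curvature_fan by linarith
  also have "\<dots> \<longleftrightarrow> (\<Sum>i<n - 1. vertex_excess i) = 0 \<and> (\<Sum>i<n - 2. apex_excess i) = 0"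
    by (intro add_nonneg_eq_0_iff sum_nonneg vertex_excess_nonneg apex_excess_nonneg) auto
  also have "\<dots> \<longleftrightarrow> (\<forall>i<n - 1. vertex_excess i = 0) \<and> (\<forall>i<n - 2. apex_excess i = 0)"
    by (subst (1 2) sum_nonneg_eq_0_iff) (auto simp: vertex_excess_nonneg apex_excess_nonneg)
  finally show ?thesis .
qed

end

text \<open>Rotating the indices leaves the total curvature unchanged, so every vertex
  \<open>w k\<close> may serve as apex, and the vertex excesses of its fan vanish too.\<close>

lemma (in closed_polygon) total_curvature_eq_2piD:
  assumes eq: "total_curvature n w = 2 * pi" and "w k \<noteq> w (Suc i)"
  shows "angle_excess (w i - w (Suc i)) (w k - w (Suc i)) (w (Suc (Suc i)) - w (Suc i)) = 0"
proof -
  interpret s: closed_polygon n "\<lambda>i. w (i + k)"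
    by (rule closed_polygon_shift)
  \<comment> \<open>\<open>j\<close> is the position of \<open>w i\<close> counted from
    \<open>w k\<close>; adding \<open>(n - 1) * k\<close> subtracts \<open>k\<close> modulo
    \<open>n\<close>.\<close>
  obtain j where j: "j < n" "(j + k) mod n = i mod n"
  proof
    show "(i + (n - 1) * k) mod n < n"
      using n_pos by simp
    have "i + (n - 1) * k + k = i + n * k"
      using n_pos by (cases n) auto
    then show "((i + (n - 1) * k) mod n + k) mod n = i mod n"
      by (metis mod_add_left_eq mod_mult_self2)
  qed
  have e: "w (j + k) = w i" "w (Suc (j + k)) = w (Suc i)" "w (Suc (Suc (j + k))) = w (Suc (Suc i))"
    using j(2) by (auto simp: w_eq_iff intro: mod_Suc_eq[THEN trans[OF sym]]) (metis mod_Suc_eq)+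
  have "j \<noteq> n - 1"
  proof
    assume "j = n - 1"
    then have "w (Suc (j + k)) = w k"
      using n_pos periodic[of k] by (simp add: add.commute)
    then show False
      using e assms by simp
  qed
  then have "s.vertex_excess j = 0"
    using j s.fenchel_eq_iff eq total_curvature_shift by auto
  then show ?thesis
    by (simp add: s.vertex_excess_def e)
qed

section \<open>Planar convex polygons\<close>

text \<open>For \<open>x\<close> and \<open>y\<close> orthogonal to \<open>N\<close> this is the
  planar determinant scaled by the length of \<open>N\<close>. It gives orientation in a plane of
  space without coordinates.\<close>

definition signed_area :: "real^3 \<Rightarrow> real^3 \<Rightarrow> real^3 \<Rightarrow> real" where
  "signed_area N x y = N \<bullet> cross3 x y"

lemma signed_area_simps [simp]:
  "signed_area N (x + x') y = signed_area N x y + signed_area N x' y"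
  "signed_area N (- x) y = - signed_area N x y"
  "signed_area N (c *\<^sub>R x) y = c * signed_area N x y"
  "signed_area N x (y + y') = signed_area N x y + signed_area N x y'"
  "signed_area N x (- y) = - signed_area N x y"
  "signed_area N x (c *\<^sub>R y) = c * signed_area N x y"
  "signed_area N x x = 0" "signed_area N 0 y = 0" "signed_area N x 0 = 0"
  "signed_area (- N) x y = - signed_area N x y"
  by (simp_all add: signed_area_def cross3_simps)

lemma signed_area_diff:
  "signed_area N (x - x') y = signed_area N x y - signed_area N x' y"
  "signed_area N x (y - y') = signed_area N x y - signed_area N x y'"
  by (simp_all add: signed_area_def cross3_simps)

lemma signed_area_skew: "signed_area N y x = - signed_area N x y"
  by (simp add: signed_area_def cross3_simps)

lemma signed_area_rotate: "signed_area N (q - p) (r - p) = signed_area N (r - q) (p - q)"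
  by (simp add: signed_area_def cross3_simps)

lemma cross3_eq_signed_area:
  assumes "N \<bullet> x = 0" "N \<bullet> y = 0"
  shows "(N \<bullet> N) *\<^sub>R cross3 x y = signed_area N x y *\<^sub>R N"
proof -
  have "cross3 N (cross3 x y) = 0"
    using assms by (simp add: Lagrange)
  then have "cross3 N (cross3 N (cross3 x y)) = 0"
    by simp
  then show ?thesis
    unfolding Lagrange[of N N] by (simp add: signed_area_def)
qed

text \<open>The expansion of \<open>x\<close> in the orthogonal frame \<open>D\<close>,
  \<open>cross3 N D\<close> of the plane, with denominators cleared.\<close>

lemma plane_expansion:
  assumes "N \<bullet> D = 0" "N \<bullet> x = 0"
  shows "((N \<bullet> N) * (D \<bullet> D)) *\<^sub>R x =
    ((N \<bullet> N) * (D \<bullet> x)) *\<^sub>R D + signed_area N D x *\<^sub>R cross3 N D"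
proof -
  have "(D \<bullet> D) *\<^sub>R x = (D \<bullet> x) *\<^sub>R D - cross3 D (cross3 D x)"
    by (simp add: Lagrange)
  then have "(N \<bullet> N) *\<^sub>R ((D \<bullet> D) *\<^sub>R x) =
      (N \<bullet> N) *\<^sub>R ((D \<bullet> x) *\<^sub>R D) - cross3 D ((N \<bullet> N) *\<^sub>R cross3 D x)"
    by (simp add: scaleR_diff_right cross_mult_right)
  also have "cross3 D ((N \<bullet> N) *\<^sub>R cross3 D x) = - (signed_area N D x *\<^sub>R cross3 N D)"
    unfolding cross3_eq_signed_area[OF assms] cross_mult_right cross_skew[of D N] by simp
  finally show ?thesis
    by simp
qed

lemma plane_functional:
  assumes "N \<bullet> D = 0" "N \<bullet> x = 0" "c \<bullet> D = 0"
  shows "((N \<bullet> N) * (D \<bullet> D)) * (c \<bullet> x) = (c \<bullet> cross3 N D) * signed_area N D x"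
  using arg_cong[OF plane_expansion[OF assms(1,2)], of "inner c"] assms(3)
  by (simp add: inner_add_right)

lemma plane_parallel:
  assumes "N \<noteq> 0" "N \<bullet> D = 0" "N \<bullet> x = 0" "D \<noteq> 0" "signed_area N D x = 0"
  obtains r where "x = r *\<^sub>R D"
proof
  have "((N \<bullet> N) * (D \<bullet> D)) *\<^sub>R x = ((N \<bullet> N) * (D \<bullet> x)) *\<^sub>R D"
    using plane_expansion[OF assms(2,3)] assms(5) by simp
  then have "(1 / ((N \<bullet> N) * (D \<bullet> D))) *\<^sub>R (((N \<bullet> N) * (D \<bullet> D)) *\<^sub>R x) =
      (1 / ((N \<bullet> N) * (D \<bullet> D))) *\<^sub>R (((N \<bullet> N) * (D \<bullet> x)) *\<^sub>R D)"
    by (simp only:)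
  then show "x = ((D \<bullet> x) / (D \<bullet> D)) *\<^sub>R D"
    using assms(1,4) by simp
qed

text \<open>Cramer's rule for three vectors of a plane. In space the relation has a further term,
  the triple product times \<open>N\<close>, which vanishes because all three are orthogonal to
  \<open>N\<close>.\<close>

lemma signed_area_Plucker:
  assumes "N \<noteq> 0" "N \<bullet> a = 0" "N \<bullet> b = 0" "N \<bullet> c = 0"
  shows "signed_area N a c *\<^sub>R b = signed_area N b c *\<^sub>R a + signed_area N a b *\<^sub>R c"
proof -
  have "(N \<bullet> N) * (b \<bullet> cross3 a c) = 0"
    using arg_cong[OF cross3_eq_signed_area[OF assms(2,4)], of "inner b"] assms(3)
    by (simp add: inner_commute)
  then have "b \<bullet> cross3 a c = 0"
    using assms(1) by simp
  moreover have "signed_area N a c *\<^sub>R b =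
      signed_area N b c *\<^sub>R a + signed_area N a b *\<^sub>R c + (b \<bullet> cross3 a c) *\<^sub>R N"
    unfolding signed_area_def by (simp add: cross3_simps forall_3)
  ultimately show ?thesis
    by simp
qed

section \<open>Planar criteria for vanishing angle excess\<close>

lemma angle_excess_antiparallel:
  assumes "x \<noteq> 0" "z \<noteq> 0" "k > 0" "z = - (k *\<^sub>R x)"
  shows "angle_excess x y z = 0"
  using assms vec_angle_minus_right[of y "k *\<^sub>R x"] vec_angle_minus_right[of x "k *\<^sub>R x"]
  by (simp add: angle_excess_def vec_angle_commute)

text \<open>If \<open>a\<close> and \<open>c\<close> span the plane,
  \<open>signed_area_Plucker\<close> makes \<open>b\<close> a nonnegative combination of them. If
  they are opposite, every \<open>b\<close> works. If they agree in direction, the signs force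
  \<open>b\<close> onto their line, and \<open>fold\<close> excludes the opposite direction.\<close>

lemma angle_excess_planar:
  assumes N: "N \<noteq> 0" "N \<bullet> a = 0" "N \<bullet> b = 0" "N \<bullet> c = 0"
    and nz: "a \<noteq> 0" "b \<noteq> 0" "c \<noteq> 0"
    and sgn: "0 \<le> signed_area N a b" "0 \<le> signed_area N b c" "0 \<le> signed_area N a c"
    and fold: "\<And>r j. c = r *\<^sub>R a \<Longrightarrow> b = j *\<^sub>R a \<Longrightarrow> r > 0 \<Longrightarrow> j \<ge> 0"
  shows "angle_excess a b c = 0"
proof (cases "signed_area N a c = 0")
  case False
  then have pos: "0 < signed_area N a c"
    using sgn by simp
  have "(1 / signed_area N a c) *\<^sub>R (signed_area N a c *\<^sub>R b) =
    (1 / signed_area N a c) *\<^sub>R (signed_area N b c *\<^sub>R a + signed_area N a b *\<^sub>R c)"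
    by (simp only: signed_area_Plucker[OF N])
  then have "b = (signed_area N b c / signed_area N a c) *\<^sub>R a + (signed_area N a b / signed_area N a c) *\<^sub>R c"
    using pos by (simp add: scaleR_add_right)
  then have "vec_angle a b + vec_angle b c = vec_angle a c"
    using nz sgn pos by (intro vec_angle_add) auto
  then show ?thesis
    by (simp add: angle_excess_def)
next
  case True
  obtain r where r: "c = r *\<^sub>R a"
    using plane_parallel[OF N(1,2,4) nz(1) True] .
  show ?thesis
  proof (cases "r > 0")
    case True
    have "signed_area N a b = 0"
      using sgn(1,2) True by (simp add: r signed_area_skew[of N b a] mult_le_0_iff)
    then obtain j where j: "b = j *\<^sub>R a"
      using plane_parallel[OF N(1,2,3) nz(1)] by blast
    then have "j > 0"
      using fold[OF r j True] nz by (cases "j = 0") auto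
    then show ?thesis
      using True nz by (simp add: angle_excess_def r j)
  next
    case False
    then have "r \<noteq> 0" "r < 0"
      using nz r by (auto simp: not_less le_less)
    then show ?thesis
      using angle_excess_antiparallel[of a c "- r" b] nz r by simp
  qed
qed

text \<open>A vertex may lie on an edge only as one of its ends, whereas crossings of edges are
  allowed. This prevents an edge from folding back on its predecessor.\<close>

locale simple_polygon = closed_polygon n w for n and w :: "nat \<Rightarrow> real^3" +
  assumes vertex_on_edge: "w k \<in> closed_segment (w i) (w (Suc i)) \<Longrightarrow> w k = w i \<or> w k = w (Suc i)"
begin

definition edge_area :: "real^3 \<Rightarrow> nat \<Rightarrow> nat \<Rightarrow> real" where
  "edge_area N i k = signed_area N (w (Suc i) - w i) (w k - w i)"

text \<open>The side may vary with \<open>i\<close>; that one sign of \<open>N\<close> works for all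
  edges at once has to be derived.\<close>

definition supporting_line :: "real^3 \<Rightarrow> nat \<Rightarrow> bool" where
  "supporting_line N i \<longleftrightarrow> (\<forall>k. 0 \<le> edge_area N i k) \<or> (\<forall>k. edge_area N i k \<le> 0)"

lemma w_Suc_Suc_neq: "w (Suc (Suc i)) \<noteq> w i"
  using n_ge_3 by (auto simp: w_eq_iff mod_Suc split: if_splits)

text \<open>A ratio in [0, 1] would put \<open>w (Suc (Suc i))\<close> on edge \<open>i\<close>, and
  a ratio above 1 would put \<open>w i\<close> on edge \<open>Suc i\<close>.\<close>

lemma no_fold:
  assumes "w (Suc (Suc i)) - w (Suc i) = r *\<^sub>R (w i - w (Suc i))"
  shows "r < 0"
proof (rule ccontr)
  assume "\<not> r < 0"
  then consider "0 \<le> r" "r \<le> 1" | "1 < r"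
    by linarith
  then show False
  proof cases
    case 1
    have "w (Suc (Suc i)) = (1 - (1 - r)) *\<^sub>R w i + (1 - r) *\<^sub>R w (Suc i)"
      using assms by (simp add: algebra_simps)
    then have "w (Suc (Suc i)) \<in> closed_segment (w i) (w (Suc i))"
      unfolding in_segment(1) using 1 by (intro exI[of _ "1 - r"]) auto
    then show False
      using vertex_on_edge w_Suc_neq w_Suc_Suc_neq by metis
  next
    case 2
    have "(1 / r) *\<^sub>R (w (Suc (Suc i)) - w (Suc i)) = w i - w (Suc i)"
      unfolding assms using 2 by simp
    then have "w i = (1 - 1 / r) *\<^sub>R w (Suc i) + (1 / r) *\<^sub>R w (Suc (Suc i))"
      by (simp add: algebra_simps)
    then have "w i \<in> closed_segment (w (Suc i)) (w (Suc (Suc i)))"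
      unfolding in_segment(1) using 2 by (intro exI[of _ "1 / r"]) auto
    then show False
      using vertex_on_edge w_Suc_neq w_Suc_Suc_neq by metis
  qed
qed

lemma edge_area_Suc_straight:
  assumes "w (Suc (Suc i)) - w (Suc i) = - (r *\<^sub>R (w i - w (Suc i)))"
  shows "edge_area N (Suc i) k = r * edge_area N i k"
proof -
  have "w k - w (Suc i) = (w k - w i) - (w (Suc i) - w i)"
    by simp
  moreover have "w (Suc (Suc i)) - w (Suc i) = r *\<^sub>R (w (Suc i) - w i)"
    using assms by (simp add: algebra_simps)
  ultimately show ?thesis
    by (simp only: edge_area_def signed_area_simps signed_area_diff(2)[of N _ "w k - w i"]) simp
qed

lemma edge_area_Suc: "edge_area N (Suc i) i = edge_area N i (Suc (Suc i))"
  by (simp add: edge_area_def signed_area_rotate[of N "w (Suc i)" "w i"])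

lemma edge_area_cong:
  "i mod n = i' mod n \<Longrightarrow> edge_area N i k = edge_area N i' k"
  unfolding edge_area_def using w_eq_iff[of i i'] w_eq_iff[of "Suc i" "Suc i'"] mod_Suc_eq by metis

text \<open>Equality in the triangle inequality for angles, applied to the diagonal towards
  \<open>w k\<close>, confines \<open>w k\<close> to the angular sector at the corner
  \<open>w (Suc i)\<close>.\<close>

lemma between:
  assumes eq: "total_curvature n w = 2 * pi"
    and bend: "vec_angle (w i - w (Suc i)) (w (Suc (Suc i)) - w (Suc i)) \<noteq> pi"
  obtains \<alpha> \<gamma> where "\<alpha> \<ge> 0" "\<gamma> \<ge> 0"
    "w k - w (Suc i) = \<alpha> *\<^sub>R (w i - w (Suc i)) + \<gamma> *\<^sub>R (w (Suc (Suc i)) - w (Suc i))"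
proof (cases "w k = w (Suc i)")
  case True
  then show ?thesis
    by (intro that[of 0 0]) auto
next
  case False
  show ?thesis
  proof (rule vec_angle_triangle_eqD[OF _ _ _ _ bend])
    show "vec_angle (w i - w (Suc i)) (w k - w (Suc i)) + vec_angle (w k - w (Suc i)) (w (Suc (Suc i)) - w (Suc i))
      = vec_angle (w i - w (Suc i)) (w (Suc (Suc i)) - w (Suc i))"
      using total_curvature_eq_2piD[OF eq False] by (simp add: angle_excess_def)
  qed (use False w_Suc_neq[of i] w_Suc_neq[of "Suc i"] that in auto)
qed

text \<open>At a straight vertex both edges span the same line; at a bend all vertices lie in the
  sector of the corner, hence on one side of the next edge.\<close>

lemma supporting_line_Suc:
  assumes "total_curvature n w = 2 * pi" "supporting_line N i"
  shows "supporting_line N (Suc i)"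
proof (cases "vec_angle (w i - w (Suc i)) (w (Suc (Suc i)) - w (Suc i)) = pi")
  case True
  obtain r where r: "r > 0" "w (Suc (Suc i)) - w (Suc i) = - (r *\<^sub>R (w i - w (Suc i)))"
    using vec_angle_eq_piD[OF _ _ True] w_Suc_neq[of i] w_Suc_neq[of "Suc i"] by auto
  then show ?thesis
    using assms(2) edge_area_Suc_straight[OF r(2), of N]
    by (simp add: supporting_line_def zero_le_mult_iff mult_le_0_iff)
next
  case False
  define s where "s = signed_area N (w (Suc (Suc i)) - w (Suc i)) (w i - w (Suc i))"
  have "\<exists>\<alpha>\<ge>0. edge_area N (Suc i) k = \<alpha> * s" for k
    by (rule between[OF assms(1) False, of k]) (auto simp: edge_area_def s_def)
  then show ?thesis
    unfolding supporting_line_def by (metis linear mult_nonneg_nonneg mult_nonneg_nonpos)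
qed

theorem total_curvature_2pi_imp_convex:
  assumes eq: "total_curvature n w = 2 * pi"
  obtains N where "N \<noteq> 0" "\<And>k. N \<bullet> w k = N \<bullet> w 0" "\<And>i. supporting_line N i"
proof -
  \<comment> \<open>A polygon that is straight at every vertex would have total curvature 0.\<close>
  obtain i where bend: "vec_angle (w i - w (Suc i)) (w (Suc (Suc i)) - w (Suc i)) \<noteq> pi"
  proof (rule ccontr)
    assume "\<not> thesis"
    then have "vec_angle (w i - w (Suc i)) (w (Suc (Suc i)) - w (Suc i)) = pi" for i
      using that by blast
    then have "vec_angle (w (Suc i) - w i) (w (Suc (Suc i)) - w (Suc i)) = 0" for i
      using vec_angle_minus_left[of "w i - w (Suc i)"] by simp
    then show False
      using eq by (simp add: total_curvature_def)
  qed
  define a c where "a = w i - w (Suc i)" and "c = w (Suc (Suc i)) - w (Suc i)"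
  have nz: "a \<noteq> 0" "c \<noteq> 0"
    using w_Suc_neq[of i] w_Suc_neq[of "Suc i"] by (auto simp: a_def c_def)
  \<comment> \<open>The plane is spanned by the two edges at the bend: if they were parallel, the
    polygon would fold back or be straight there.\<close>
  define N where "N = cross3 a c"
  have comb: "\<exists>\<alpha> \<gamma>. \<alpha> \<ge> 0 \<and> \<gamma> \<ge> 0 \<and> w k - w (Suc i) = \<alpha> *\<^sub>R a + \<gamma> *\<^sub>R c" for k
    by (rule between[OF eq bend, of k]) (auto simp: a_def c_def)
  have "N \<noteq> 0"
  proof
    assume "N = 0"
    then have "collinear {0, a, c}"
      by (simp add: N_def cross_eq_0)
    then obtain r where r: "c = r *\<^sub>R a"
      using nz by (auto simp: collinear_lemma)
    then have "r < 0"
      using no_fold by (simp add: a_def c_def)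
    then have "vec_angle a c = pi"
      using vec_angle_minus_scaleR[OF nz(1), of "- r"] by (simp add: r)
    then show False
      using bend by (simp add: a_def c_def)
  qed
  moreover have plane: "N \<bullet> w k = N \<bullet> w (Suc i)" for k
  proof -
    obtain \<alpha> \<gamma> where "w k - w (Suc i) = \<alpha> *\<^sub>R a + \<gamma> *\<^sub>R c"
      using comb by blast
    then have "N \<bullet> (w k - w (Suc i)) = 0"
      by (simp add: N_def inner_add_right dot_cross_self)
    then show ?thesis
      by (simp add: inner_diff_right)
  qed
  moreover have "supporting_line N (Suc i + j)" for j
  proof (induction j)
    case 0
    have "\<exists>\<alpha>\<ge>0. edge_area N (Suc i) k = \<alpha> * signed_area N c a" for k
      using comb[of k] by (auto simp: edge_area_def c_def[symmetric])
    moreover have "signed_area N c a \<le> 0"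
      by (simp add: signed_area_skew[of N c a]) (simp add: signed_area_def N_def)
    ultimately show ?case
      by (auto simp: supporting_line_def) (metis mult_nonneg_nonpos)
  next
    case (Suc j)
    then show ?case
      using supporting_line_Suc[OF eq] by simp
  qed
  then have "supporting_line N k" for k
  proof -
    \<comment> \<open>Adding \<open>Suc i\<close> full periods to \<open>k\<close> gives an index
      beyond the start, so every edge is reached.\<close>
    have "Suc i + (k + (n - 1) * Suc i) = k + n * Suc i"
      using n_pos by (cases n) auto
    then have "(Suc i + (k + (n - 1) * Suc i)) mod n = k mod n"
      by (metis mod_mult_self2)
    then show ?thesis
      using \<open>supporting_line N (Suc i + (k + (n - 1) * Suc i))\<close> edge_area_cong
      unfolding supporting_line_def by metis
  qed
  ultimately show ?thesis
    using that by metis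
qed

lemma total_curvature_of_convex_aux:
  assumes N: "N \<noteq> 0" and plane: "\<And>k. N \<bullet> w k = N \<bullet> w 0"
    and left: "\<And>i k. 0 \<le> edge_area N i k"
  shows "total_curvature n w = 2 * pi"
  unfolding fenchel_eq_iff
proof (intro conjI allI impI)
  have orth: "N \<bullet> (w j - w k) = 0" for j k
    using plane[of j] plane[of k] by (simp add: inner_diff_right)
  fix i
  show "vertex_excess i = 0" if "i < n - 1"
    unfolding vertex_excess_def
  \<comment> \<open>At a corner the direction back to \<open>w i\<close> turns clockwise into the
    direction of \<open>w (Suc (Suc i))\<close>, hence the reversed normal.\<close>
  proof (rule angle_excess_planar[of "- N"])
    show "0 \<le> signed_area (- N) (w i - w (Suc i)) (w 0 - w (Suc i))"
      using left[of i 0] unfolding edge_area_def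
        signed_area_rotate[of N "w (Suc i)" "w i"] signed_area_skew[of N "w 0 - w (Suc i)"] by simp
    show "0 \<le> signed_area (- N) (w 0 - w (Suc i)) (w (Suc (Suc i)) - w (Suc i))"
      using left[of "Suc i" 0] by (simp add: edge_area_def signed_area_skew[of N _ "w 0 - w (Suc i)"])
    show "0 \<le> signed_area (- N) (w i - w (Suc i)) (w (Suc (Suc i)) - w (Suc i))"
      using left[of "Suc i" i] by (simp add: edge_area_def signed_area_skew[of N _ "w i - w (Suc i)"])
    show "0 \<le> j" if "w (Suc (Suc i)) - w (Suc i) = r *\<^sub>R (w i - w (Suc i))" "0 < r" for r j :: real
      using no_fold[OF that(1)] that(2) by simp
  qed (use N orth that w_neq[of 0 "Suc i"] w_Suc_neq[of i] w_Suc_neq[of "Suc i"] in auto)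
  show "apex_excess i = 0" if "i < n - 2"
    unfolding apex_excess_def
  proof (rule angle_excess_planar[of N])
    have neq: "w 0 \<noteq> w (Suc i)" "w 0 \<noteq> w (Suc (Suc i))"
      using that w_neq[of 0 "Suc i"] w_neq[of 0 "Suc (Suc i)"] by (auto simp: less_diff_conv)
    then show "w (Suc i) - w 0 \<noteq> 0" "w (Suc (Suc i)) - w 0 \<noteq> 0"
      by auto
    show "0 \<le> signed_area N (w 1 - w 0) (w (Suc i) - w 0)"
      "0 \<le> signed_area N (w 1 - w 0) (w (Suc (Suc i)) - w 0)"
      using left[of 0 "Suc i"] left[of 0 "Suc (Suc i)"] by (simp_all add: edge_area_def)
    show "0 \<le> signed_area N (w (Suc i) - w 0) (w (Suc (Suc i)) - w 0)"
      using left[of "Suc i" 0] by (simp add: edge_area_def signed_area_rotate[of N "w (Suc i)" "w 0"])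
    show "0 \<le> j"
      if c: "w (Suc (Suc i)) - w 0 = r *\<^sub>R (w 1 - w 0)" and b: "w (Suc i) - w 0 = j *\<^sub>R (w 1 - w 0)" and "0 < r"
      for r j
    proof (rule ccontr)
      assume "\<not> 0 \<le> j"
      \<comment> \<open>The weight at which the combination of \<open>j\<close> and \<open>r\<close>
        is 0; it would place \<open>w 0\<close> on the edge from \<open>w (Suc i)\<close> to
        \<open>w (Suc (Suc i))\<close>.\<close>
      define t where "t = - j / (r - j)"
      have t: "0 \<le> t" "t \<le> 1" "(1 - t) * j + t * r = 0"
        using \<open>0 < r\<close> \<open>\<not> 0 \<le> j\<close> by (auto simp: t_def field_simps)
      have "(1 - t) *\<^sub>R (w (Suc i) - w 0) + t *\<^sub>R (w (Suc (Suc i)) - w 0) = ((1 - t) * j + t * r) *\<^sub>R (w 1 - w 0)"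
        unfolding b c by (simp add: scaleR_left_distrib)
      then have "(1 - t) *\<^sub>R (w (Suc i) - w 0) + t *\<^sub>R (w (Suc (Suc i)) - w 0) = 0"
        by (simp only: t(3) scaleR_zero_left)
      then have "w 0 = (1 - t) *\<^sub>R w (Suc i) + t *\<^sub>R w (Suc (Suc i))"
        by (simp add: algebra_simps)
      then have "w 0 \<in> closed_segment (w (Suc i)) (w (Suc (Suc i)))"
        using t by (auto simp: in_segment)
      then show False
        using vertex_on_edge neq by blast
    qed
  qed (use N orth w_Suc_neq[of 0] in auto)
qed

text \<open>The sides of successive edges are matched by induction. Neighbouring edges share the
  triangle of three successive vertices: a nonzero area forces equal sides, and for area 0 the
  polygon is straight there, so both edges span the same line. The first edge decides the sign of
  \<open>N\<close>.\<close>

theorem convex_imp_total_curvature_2pi: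
  assumes N: "N \<noteq> 0" and plane: "\<And>k. N \<bullet> w k = N \<bullet> w 0"
    and supp: "\<And>i. supporting_line N i"
  shows "total_curvature n w = 2 * pi"
proof -
  have left: "0 \<le> edge_area M i k"
    if M: "M = N \<or> M = - N" and 0: "\<And>k. 0 \<le> edge_area M 0 k" for M i k
  proof (induction i arbitrary: k)
    case (Suc i)
    have supp': "supporting_line M (Suc i)"
      using M supp[of "Suc i"] by (auto simp: supporting_line_def edge_area_def)
    show ?case
    proof (cases "\<forall>k. 0 \<le> edge_area M (Suc i) k")
      case False
      then have "edge_area M (Suc i) i \<le> 0"
        using supp' by (auto simp: supporting_line_def)
      then have "edge_area M (Suc i) i = 0"
        using Suc.IH[of "Suc (Suc i)"] by (simp add: edge_area_Suc)
      then have "signed_area M (w i - w (Suc i)) (w (Suc (Suc i)) - w (Suc i)) = 0"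
        by (simp add: edge_area_def signed_area_skew[of M "w i - w (Suc i)"])
      moreover have "M \<noteq> 0" "M \<bullet> (w j - w k) = 0" for j k
        using M N plane[of j] plane[of k] by (auto simp: inner_diff_right)
      ultimately obtain r where r: "w (Suc (Suc i)) - w (Suc i) = r *\<^sub>R (w i - w (Suc i))"
        using plane_parallel[of M "w i - w (Suc i)"] w_Suc_neq[of i] by (metis right_minus_eq)
      then show ?thesis
        using edge_area_Suc_straight[of i "- r" M k] no_fold[OF r] Suc.IH[of k]
        by (simp add: mult_nonpos_nonneg)
    qed simp
  qed (rule 0)
  from supp[of 0] obtain M where M: "M = N \<or> M = - N" and 0: "\<And>k. 0 \<le> edge_area M 0 k"
    unfolding supporting_line_def by (metis edge_area_def neg_0_le_iff_le signed_area_simps(10))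
  show ?thesis
  proof (rule total_curvature_of_convex_aux)
    show "M \<noteq> 0" "M \<bullet> w k = M \<bullet> w 0" for k
      using M N plane[of k] by auto
  qed (rule left[OF M 0])
qed

end

section \<open>Supporting lines as linear inequalities\<close>

lemma one_signed_scale:
  fixes f :: "'a \<Rightarrow> real"
  assumes "(\<forall>k. 0 \<le> f k) \<or> (\<forall>k. f k \<le> 0)"
  shows "(\<forall>k. 0 \<le> b * f k) \<or> (\<forall>k. b * f k \<le> 0)"
  using assms by (cases "0 \<le> b") (auto simp: zero_le_mult_iff mult_le_0_iff)

context simple_polygon
begin

text \<open>On the plane of the polygon, a functional constant along edge \<open>i\<close> is, up to
  an additive constant, a multiple of \<open>edge_area\<close>.\<close>

lemma edge_functional:
  assumes "\<And>k. N \<bullet> w k = N \<bullet> w 0" "c \<bullet> (w (Suc i) - w i) = 0"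
  shows "((N \<bullet> N) * ((w (Suc i) - w i) \<bullet> (w (Suc i) - w i))) * (c \<bullet> (w k - w i)) =
    (c \<bullet> cross3 N (w (Suc i) - w i)) * edge_area N i k"
proof -
  have "N \<bullet> (w j - w i) = 0" for j
    using assms(1)[of i] assms(1)[of j] by (simp add: inner_diff_right)
  then show ?thesis
    unfolding edge_area_def using assms(2) by (intro plane_functional)
qed

lemma supporting_line_imp_one_side:
  assumes N: "N \<noteq> 0" "\<And>k. N \<bullet> w k = N \<bullet> w 0" and c: "c \<bullet> (w (Suc i) - w i) = 0"
    and supp: "supporting_line N i"
  shows "(\<forall>k. c \<bullet> w k \<le> c \<bullet> w i) \<or> (\<forall>k. c \<bullet> w i \<le> c \<bullet> w k)"
proof -
  define M where "M = (N \<bullet> N) * ((w (Suc i) - w i) \<bullet> (w (Suc i) - w i))"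
  have "M > 0"
    using N(1) w_Suc_neq[of i] by (simp add: M_def)
  define b where "b = (c \<bullet> cross3 N (w (Suc i) - w i)) / M"
  have "M * (c \<bullet> w k - c \<bullet> w i) = (b * M) * edge_area N i k" for k
    using edge_functional[OF N(2) c, of k] \<open>M > 0\<close>
    by (simp add: b_def M_def[symmetric] inner_diff_right[of c "w k"])
  then have eq: "c \<bullet> w k - c \<bullet> w i = b * edge_area N i k" for k
    using \<open>M > 0\<close> by (simp add: mult.commute[of b M] mult.assoc)
  have "(\<forall>k. 0 \<le> b * edge_area N i k) \<or> (\<forall>k. b * edge_area N i k \<le> 0)"
    using supp unfolding supporting_line_def by (rule one_signed_scale)
  then show ?thesis
    unfolding eq[symmetric] by auto
qed

text \<open>The vector \<open>x\<close>, parallel to the plane of the polygon, certifies that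
  \<open>c\<close> is not constant on that plane, so the factor \<open>b\<close> is nonzero and can
  be divided by.\<close>

lemma one_side_imp_supporting_line:
  assumes N: "N \<noteq> 0" "\<And>k. N \<bullet> w k = N \<bullet> w 0" and c: "c \<bullet> (w (Suc i) - w i) = 0"
    and x: "N \<bullet> x = 0" "c \<bullet> x \<noteq> 0"
    and side: "(\<forall>k. c \<bullet> w k \<le> c \<bullet> w i) \<or> (\<forall>k. c \<bullet> w i \<le> c \<bullet> w k)"
  shows "supporting_line N i"
proof -
  define D where "D = w (Suc i) - w i"
  have "N \<bullet> D = 0" "c \<bullet> D = 0" "D \<noteq> 0"
    using N(2)[of i] N(2)[of "Suc i"] c w_Suc_neq[of i] by (simp_all add: D_def inner_diff_right)
  define M b where "M = (N \<bullet> N) * (D \<bullet> D)" and "b = c \<bullet> cross3 N D"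
  have "M > 0"
    using N(1) \<open>D \<noteq> 0\<close> by (simp add: M_def)
  have "b \<noteq> 0"
    using plane_functional[OF \<open>N \<bullet> D = 0\<close> x(1) \<open>c \<bullet> D = 0\<close>] x(2) \<open>M > 0\<close>
    unfolding M_def b_def by auto
  have "M * (c \<bullet> w k - c \<bullet> w i) = b * edge_area N i k" for k
    using edge_functional[OF N(2) c, of k]
    by (simp only: b_def M_def D_def inner_diff_right[of c "w k"])
  then have eq: "edge_area N i k = (M / b) * (c \<bullet> w k - c \<bullet> w i)" for k
    using \<open>b \<noteq> 0\<close> by simp
  have "(\<forall>k. 0 \<le> c \<bullet> w k - c \<bullet> w i) \<or> (\<forall>k. c \<bullet> w k - c \<bullet> w i \<le> 0)"
    using side by auto
  then show ?thesis
    unfolding supporting_line_def eq by (rule one_signed_scale)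
qed

end

section \<open>Circumcircles\<close>

lemma collinear_3_diff:
  fixes p :: "'a::euclidean_space"
  shows "collinear {p, q, r} \<longleftrightarrow> collinear {0, q - p, r - p}"
proof -
  have "{p, q, r} = {q, p, r}"
    by blast
  then show ?thesis
    using collinear_3[of q p r] by (simp only: NO_MATCH_def)
qed

lemma equidistant_iff:
  fixes c p q :: "'a::euclidean_space"
  shows "dist c q = dist c p \<longleftrightarrow> (q - p) \<bullet> (q - p) = 2 * ((c - p) \<bullet> (q - p))"
proof -
  have "dist c q = dist c p \<longleftrightarrow> (c - q) \<bullet> (c - q) = (c - p) \<bullet> (c - p)"
    by (simp add: dist_norm norm_eq)
  also have "c - q = (c - p) - (q - p)"
    by simp
  also have "\<dots> \<bullet> \<dots> = (c - p) \<bullet> (c - p) - 2 * ((c - p) \<bullet> (q - p)) + (q - p) \<bullet> (q - p)"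
    unfolding inner_diff_left[of "c - p" "q - p"] inner_diff_right[of _ "c - p" "q - p"]
      inner_commute[of "q - p" "c - p"] by simp
  finally show ?thesis
    by auto
qed

text \<open>With \<open>p\<close> as origin, equidistance is a linear system for the coordinates of
  the centre in \<open>x\<close> and \<open>y\<close>. Its Gram determinant \<open>d\<close> is
  positive by strict Cauchy-Schwarz; \<open>s\<close> and \<open>t\<close> are Cramer's
  solution.\<close>

lemma ex1_circumcenter:
  fixes p q r :: "'a::euclidean_space"
  assumes "\<not> collinear {p, q, r}"
  shows "\<exists>!c. c \<in> affine hull {p, q, r} \<and> (\<exists>\<rho>. \<forall>x\<in>{p, q, r}. dist c x = \<rho>)"
proof -
  define x y where "x = q - p" and "y = r - p"
  define d where "d = (x \<bullet> x) * (y \<bullet> y) - (x \<bullet> y)\<^sup>2"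
  have "\<not> collinear {0, x, y}"
    using assms collinear_3_diff[of p q r] unfolding x_def y_def by blast
  then have "\<bar>x \<bullet> y\<bar> \<noteq> norm x * norm y"
    by (simp add: norm_cauchy_schwarz_equal)
  then have "\<bar>x \<bullet> y\<bar> < norm x * norm y"
    using Cauchy_Schwarz_ineq2[of x y] by simp
  then have "(x \<bullet> y)\<^sup>2 < (norm x * norm y)\<^sup>2"
    by (metis abs_ge_zero power2_abs power_strict_mono zero_less_numeral)
  then have "d > 0"
    unfolding d_def power_mult_distrib power2_norm_eq_inner by linarith
  have hull: "c \<in> affine hull {p, q, r} \<longleftrightarrow> (\<exists>s t. c - p = s *\<^sub>R x + t *\<^sub>R y)" for c
    unfolding affine_hull_3 mem_Collect_eq
  proof (intro iffI; elim exE conjE)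
    fix u s t
    assume c: "c = u *\<^sub>R p + s *\<^sub>R q + t *\<^sub>R r" and "u + s + t = 1"
    then have u: "u = 1 - s - t"
      by simp
    have "c - p = s *\<^sub>R x + t *\<^sub>R y"
      unfolding c u x_def y_def by (simp add: algebra_simps)
    then show "\<exists>s t. c - p = s *\<^sub>R x + t *\<^sub>R y"
      by blast
  next
    fix s t
    assume "c - p = s *\<^sub>R x + t *\<^sub>R y"
    then have "c = (1 - s - t) *\<^sub>R p + s *\<^sub>R q + t *\<^sub>R r"
      unfolding x_def y_def by (simp add: algebra_simps)
    then show "\<exists>u s t. c = u *\<^sub>R p + s *\<^sub>R q + t *\<^sub>R r \<and> u + s + t = 1"
      by (intro exI[of _ "1 - s - t"] exI[of _ s] exI[of _ t]) simp
  qed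
  have equi: "(\<exists>\<rho>. \<forall>z\<in>{p, q, r}. dist c z = \<rho>) \<longleftrightarrow>
      x \<bullet> x = 2 * ((c - p) \<bullet> x) \<and> y \<bullet> y = 2 * ((c - p) \<bullet> y)" for c
    using equidistant_iff[of c q p] equidistant_iff[of c r p] by (auto simp: x_def y_def)
  define s t where "s = (y \<bullet> y) * (x \<bullet> x - x \<bullet> y) / (2 * d)"
    and "t = (x \<bullet> x) * (y \<bullet> y - x \<bullet> y) / (2 * d)"
  have s: "2 * d * s = (y \<bullet> y) * (x \<bullet> x - x \<bullet> y)" and t: "2 * d * t = (x \<bullet> x) * (y \<bullet> y - x \<bullet> y)"
    using \<open>d > 0\<close> by (simp_all add: s_def t_def)
  have "d * (2 * ((s *\<^sub>R x + t *\<^sub>R y) \<bullet> x)) = (2 * d * s) * (x \<bullet> x) + (2 * d * t) * (x \<bullet> y)"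
    unfolding inner_add_left inner_scaleR_left inner_commute[of y x] by (simp add: algebra_simps)
  also have "\<dots> = d * (x \<bullet> x)"
    unfolding s t by (simp add: d_def power2_eq_square algebra_simps)
  finally have st1: "x \<bullet> x = 2 * ((s *\<^sub>R x + t *\<^sub>R y) \<bullet> x)"
    using \<open>d > 0\<close> by simp
  have "d * (2 * ((s *\<^sub>R x + t *\<^sub>R y) \<bullet> y)) = (2 * d * s) * (x \<bullet> y) + (2 * d * t) * (y \<bullet> y)"
    unfolding inner_add_left inner_scaleR_left by (simp add: algebra_simps)
  also have "\<dots> = d * (y \<bullet> y)"
    unfolding s t by (simp add: d_def power2_eq_square algebra_simps)
  finally have st2: "y \<bullet> y = 2 * ((s *\<^sub>R x + t *\<^sub>R y) \<bullet> y)"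
    using \<open>d > 0\<close> by simp
  show ?thesis
    unfolding hull equi
  proof (rule ex1I)
    let ?c = "p + (s *\<^sub>R x + t *\<^sub>R y)"
    show "(\<exists>s t. ?c - p = s *\<^sub>R x + t *\<^sub>R y) \<and> x \<bullet> x = 2 * ((?c - p) \<bullet> x) \<and> y \<bullet> y = 2 * ((?c - p) \<bullet> y)"
      unfolding add_diff_cancel_left' using st1 st2 by blast
  next
    fix c
    assume c: "(\<exists>s t. c - p = s *\<^sub>R x + t *\<^sub>R y) \<and> x \<bullet> x = 2 * ((c - p) \<bullet> x) \<and> y \<bullet> y = 2 * ((c - p) \<bullet> y)"
    then obtain s' t' where s't': "c - p = s' *\<^sub>R x + t' *\<^sub>R y"
      by blast
    \<comment> \<open>The difference of two solutions lies in the span of \<open>x\<close> and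
      \<open>y\<close> and is orthogonal to both.\<close>
    define e where "e = (c - p) - (s *\<^sub>R x + t *\<^sub>R y)"
    have e: "e = (s' - s) *\<^sub>R x + (t' - t) *\<^sub>R y"
      unfolding e_def s't' by (simp add: algebra_simps)
    have "e \<bullet> x = 0" "e \<bullet> y = 0"
      using c st1 st2 by (simp_all only: e_def inner_diff_left) simp_all
    then have "e \<bullet> ((s' - s) *\<^sub>R x + (t' - t) *\<^sub>R y) = 0"
      by (simp add: inner_add_right)
    then have "e \<bullet> e = 0"
      by (simp only: e[symmetric])
    then have "c - p = s *\<^sub>R x + t *\<^sub>R y"
      unfolding e_def by simp
    then show "c = p + (s *\<^sub>R x + t *\<^sub>R y)"
      by (simp add: diff_eq_eq add.commute)
  qed
qed

lemma
  fixes p q r :: "'a::euclidean_space"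
  assumes "\<not> collinear {p, q, r}"
  defines "c \<equiv> circumcenter {p, q, r}"
  shows inner_circumcenter: "(q - p) \<bullet> (q - p) = 2 * ((c - p) \<bullet> (q - p))"
      "(r - p) \<bullet> (r - p) = 2 * ((c - p) \<bullet> (r - p))"
    and circumradius_eq: "circumradius {p, q, r} = dist c p"
proof -
  have "\<exists>\<rho>. \<forall>x\<in>{p, q, r}. dist c x = \<rho>"
    using theI'[OF ex1_circumcenter[OF assms(1)]] unfolding c_def circumcenter_def by blast
  then have d: "dist c q = dist c p" "dist c r = dist c p"
    by auto
  then show "(q - p) \<bullet> (q - p) = 2 * ((c - p) \<bullet> (q - p))" "(r - p) \<bullet> (r - p) = 2 * ((c - p) \<bullet> (r - p))"
    by (simp_all add: equidistant_iff)
  show "circumradius {p, q, r} = dist c p"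
    unfolding circumradius_def c_def[symmetric] by (rule the_equality) (use d in auto)
qed

text \<open>Lagrange's formula resolves the double cross product, and equidistance from the vertices
  eliminates the centre.\<close>

lemma circle_tangent_eq:
  assumes "\<not> collinear {p, q, r}"
  shows "2 *\<^sub>R circle_tangent p q r =
    ((r - p) \<bullet> (r - p)) *\<^sub>R (q - p) - ((q - p) \<bullet> (q - p)) *\<^sub>R (r - p)"
proof -
  define c where "c = circumcenter {p, q, r}"
  have "circle_tangent p q r = cross3 (c - p) (cross3 (q - p) (r - p))"
    unfolding circle_tangent_def c_def[symmetric]
    using cross_skew[of "cross3 (q - p) (r - p)" "p - c"] cross_minus_left[of "p - c"] by simp
  also have "\<dots> = ((c - p) \<bullet> (r - p)) *\<^sub>R (q - p) - ((c - p) \<bullet> (q - p)) *\<^sub>R (r - p)"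
    by (rule Lagrange)
  finally show ?thesis
    unfolding inner_circumcenter(1)[OF assms, folded c_def] inner_circumcenter(2)[OF assms, folded c_def]
    by (simp add: scaleR_diff_right)
qed

section \<open>Independence of the intersection angle from labelling\<close>

lemma circle_tangent_reverse: "circle_tangent p r q = - circle_tangent p q r"
  unfolding circle_tangent_def insert_commute[of r q] cross_skew[of "r - p" "q - p"] by simp

text \<open>The reflection in the perpendicular bisector plane of the segment from \<open>p\<close> to \<open>q\<close>, which
  carries the circumcircle tangent at \<open>p\<close> to the one at \<open>q\<close>.\<close>

definition reflect :: "'a::real_inner \<Rightarrow> 'a \<Rightarrow> 'a" where
  "reflect e x = x - (2 * (x \<bullet> e) / (e \<bullet> e)) *\<^sub>R e"

lemma inner_reflect: "reflect e x \<bullet> reflect e y = x \<bullet> y"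
proof (cases "e = 0")
  case False
  define k l where "k = (x \<bullet> e) / (e \<bullet> e)" and "l = (y \<bullet> e) / (e \<bullet> e)"
  have kl: "x \<bullet> e = k * (e \<bullet> e)" "y \<bullet> e = l * (e \<bullet> e)"
    using False by (simp_all add: k_def l_def)
  have "reflect e x \<bullet> reflect e y = x \<bullet> y - 2 * l * (x \<bullet> e) - 2 * k * (y \<bullet> e) + 4 * k * l * (e \<bullet> e)"
    unfolding reflect_def times_divide_eq_right[symmetric] k_def[symmetric] l_def[symmetric]
      inner_diff_left inner_diff_right inner_scaleR_left inner_scaleR_right inner_commute[of e y]
    by (simp add: algebra_simps)
  then show ?thesis
    by (simp add: kl)
qed (simp add: reflect_def)

lemma vec_angle_reflect: "vec_angle (reflect e x) (reflect e y) = vec_angle x y"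
  by (simp add: vec_angle_def inner_reflect norm_eq_sqrt_inner)

text \<open>The reflection maps the circle to itself, exchanges \<open>p\<close> and
  \<open>q\<close> and reverses the sense of traversal.\<close>

lemma circle_tangent_reflect:
  assumes "\<not> collinear {p, q, r}"
  shows "circle_tangent q p r = reflect (q - p) (circle_tangent p q r)"
proof -
  have nc: "\<not> collinear {q, p, r}"
    using assms by (simp add: insert_commute)
  define e x where "e = q - p" and "x = r - p"
  have "e \<bullet> e \<noteq> 0"
    using assms by (auto simp: e_def)
  have "2 *\<^sub>R circle_tangent q p r = ((x - e) \<bullet> (x - e)) *\<^sub>R (- e) - ((- e) \<bullet> (- e)) *\<^sub>R (x - e)"
    unfolding circle_tangent_eq[OF nc] by (simp add: e_def x_def)
  also have "\<dots> = (2 * (x \<bullet> e) - x \<bullet> x) *\<^sub>R e - (e \<bullet> e) *\<^sub>R x"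
  proof -
    have "(x - e) \<bullet> (x - e) = x \<bullet> x - 2 * (x \<bullet> e) + e \<bullet> e"
      unfolding inner_diff_left inner_diff_right inner_commute[of e x] by simp
    then show ?thesis
      by (simp add: algebra_simps)
  qed
  also have "\<dots> = 2 *\<^sub>R reflect e (circle_tangent p q r)"
  proof -
    define T where "T = circle_tangent p q r"
    have T: "2 *\<^sub>R T = (x \<bullet> x) *\<^sub>R e - (e \<bullet> e) *\<^sub>R x"
      unfolding T_def circle_tangent_eq[OF assms] by (simp add: e_def x_def)
    have "(2 *\<^sub>R T) \<bullet> e = (x \<bullet> x - x \<bullet> e) * (e \<bullet> e)"
      unfolding T by (simp add: inner_diff_left algebra_simps)
    then have "2 * (T \<bullet> e) / (e \<bullet> e) = x \<bullet> x - x \<bullet> e"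
      using \<open>e \<bullet> e \<noteq> 0\<close> by simp
    then have r: "2 *\<^sub>R reflect e T = 2 *\<^sub>R T - (2 * (x \<bullet> x - x \<bullet> e)) *\<^sub>R e"
      unfolding reflect_def by (simp add: scaleR_diff_right)
    show ?thesis
    proof -
      have "2 * (x \<bullet> e) - x \<bullet> x = x \<bullet> x - 2 * (x \<bullet> x - x \<bullet> e)"
        by simp
      then show ?thesis
        unfolding T_def[symmetric] r T by (simp only: scaleR_left_diff_distrib) simp
    qed
  qed
  finally show ?thesis
    by (simp add: e_def)
qed

definition circle_angle :: "real^3 \<Rightarrow> real^3 \<Rightarrow> real^3 \<Rightarrow> real^3 \<Rightarrow> real" where
  "circle_angle p q a b = vec_angle (circle_tangent p q a) (circle_tangent p b q)"

lemma circle_angle_swap_apexes: "circle_angle p q b a = circle_angle p q a b"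
  unfolding circle_angle_def circle_tangent_reverse[of p a q] circle_tangent_reverse[of p b q]
  by (simp add: vec_angle_minus_left vec_angle_minus_right vec_angle_commute)

lemma circle_angle_swap_ends:
  assumes "\<not> collinear {p, q, a}" "\<not> collinear {p, q, b}"
  shows "circle_angle q p a b = circle_angle p q a b"
  unfolding circle_angle_def circle_tangent_reverse[of q b p] circle_tangent_reverse[of p b q]
    circle_tangent_reflect[OF assms(1)] circle_tangent_reflect[OF assms(2)]
  by (simp add: vec_angle_minus_right vec_angle_reflect)

text \<open>\<open>beta\<close> is a definite description over all labellings of the edge and its
  two faces. These differ by exchanging the ends or the apexes, and neither exchange changes the
  angle.\<close>

lemma beta_eq_circle_angle:
  assumes faces: "{p, q, a} \<in> F" "{p, q, b} \<in> F" "a \<noteq> b"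
    and only: "\<And>f. f \<in> F \<Longrightarrow> {p, q} \<subseteq> f \<Longrightarrow> f = {p, q, a} \<or> f = {p, q, b}"
    and nondeg: "\<not> collinear {p, q, a}" "\<not> collinear {p, q, b}"
    and card: "\<And>f. f \<in> F \<Longrightarrow> card f = 3"
  shows "beta F {p, q} = circle_angle p q a b"
  unfolding beta_def circle_angle_def[symmetric]
proof (rule the_equality)
  show "\<exists>p' q' a' b'. {p, q} = {p', q'} \<and> a' \<noteq> b' \<and> {p', q', a'} \<in> F \<and> {p', q', b'} \<in> F \<and>
      circle_angle p q a b = circle_angle p' q' a' b'"
    using faces by blast
next
  fix t
  assume "\<exists>p' q' a' b'. {p, q} = {p', q'} \<and> a' \<noteq> b' \<and> {p', q', a'} \<in> F \<and> {p', q', b'} \<in> F \<and>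
      t = circle_angle p' q' a' b'"
  then obtain p' q' a' b' where e: "{p, q} = {p', q'}" and "a' \<noteq> b'"
    and f: "{p', q', a'} \<in> F" "{p', q', b'} \<in> F" and t: "t = circle_angle p' q' a' b'"
    by blast
  have third: "c = a \<or> c = b" if "{p', q', c} \<in> F" for c
  proof -
    have "insert c {p, q} \<in> F"
      using that e by (simp add: insert_commute)
    moreover have "c \<notin> {p, q}"
    proof
      assume "c \<in> {p, q}"
      then have "card (insert c {p, q}) \<le> 2"
        by (simp add: insert_absorb card_insert_le_m1)
      then show False
        using card[OF \<open>insert c {p, q} \<in> F\<close>] by simp
    qed
    ultimately show ?thesis
      using only[of "insert c {p, q}"] by auto
  qed
  have pq: "p' = p \<and> q' = q \<or> p' = q \<and> q' = p"
    using e by (auto simp: doubleton_eq_iff)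
  have ab: "a' = a \<and> b' = b \<or> a' = b \<and> b' = a"
    using third f \<open>a' \<noteq> b'\<close> by blast
  show "t = circle_angle p q a b"
    using pq ab t circle_angle_swap_apexes[of p q a b] circle_angle_swap_apexes[of q p a b]
      circle_angle_swap_ends[OF nondeg] by metis
qed

section \<open>The star of a vertex and its inversion\<close>

text \<open>Inversion in the unit sphere. Division by zero fixes the origin, so this is an
  involution of the whole space.\<close>

definition inversion :: "'a::real_inner \<Rightarrow> 'a" where
  "inversion x = (1 / (x \<bullet> x)) *\<^sub>R x"

lemma scaleR_inversion: "(x \<bullet> x) *\<^sub>R inversion x = x"
  by (cases "x = 0") (simp_all add: inversion_def)

lemma inversion_inversion: "inversion (inversion x) = x"
  by (cases "x = 0") (simp_all add: inversion_def)

lemma inversion_inject: "inversion x = inversion y \<longleftrightarrow> x = y"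
  by (metis inversion_inversion)

text \<open>Inversion in \<open>p\<close> carries the circumcircle of \<open>p, q, r\<close> to the line from the image of \<open>q\<close> to
  the image of \<open>r\<close>; leaving \<open>p\<close> towards \<open>q\<close> corresponds to arriving from infinity.\<close>

lemma circle_tangent_inversion:
  assumes "\<not> collinear {p, q, r}"
  obtains k where "k > 0" "circle_tangent p q r = k *\<^sub>R (inversion (q - p) - inversion (r - p))"
proof
  define x y where "x = q - p" and "y = r - p"
  have "p \<noteq> q" "p \<noteq> r"
    using assms collinear_3_eq_affine_dependent[of p q r] by auto
  then have "x \<noteq> 0" "y \<noteq> 0"
    by (simp_all add: x_def y_def)
  then show "(x \<bullet> x) * (y \<bullet> y) / 2 > 0"
    by simp
  have "((x \<bullet> x) * (y \<bullet> y)) *\<^sub>R (inversion x - inversion y) =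
      (y \<bullet> y) *\<^sub>R ((x \<bullet> x) *\<^sub>R inversion x) - (x \<bullet> x) *\<^sub>R ((y \<bullet> y) *\<^sub>R inversion y)"
    by (simp add: scaleR_diff_right mult.commute)
  also have "\<dots> = 2 *\<^sub>R circle_tangent p q r"
    unfolding scaleR_inversion circle_tangent_eq[OF assms] by (simp only: x_def y_def)
  finally have "(1 / 2) *\<^sub>R (((x \<bullet> x) * (y \<bullet> y)) *\<^sub>R (inversion x - inversion y)) =
      (1 / 2) *\<^sub>R (2 *\<^sub>R circle_tangent p q r)"
    by (simp only:)
  then show "circle_tangent p q r = ((x \<bullet> x) * (y \<bullet> y) / 2) *\<^sub>R (inversion (q - p) - inversion (r - p))"
    by (simp add: x_def y_def)
qed

lemma circle_angle_inversion:
  assumes "\<not> collinear {p, q, a}" "\<not> collinear {p, b, q}"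
  shows "circle_angle p q a b =
    vec_angle (inversion (q - p) - inversion (a - p)) (inversion (b - p) - inversion (q - p))"
proof -
  obtain k l where "k > 0" "circle_tangent p q a = k *\<^sub>R (inversion (q - p) - inversion (a - p))"
    "l > 0" "circle_tangent p b q = l *\<^sub>R (inversion (b - p) - inversion (q - p))"
    using circle_tangent_inversion[OF assms(1)] circle_tangent_inversion[OF assms(2)] by metis
  then show ?thesis
    by (simp add: circle_angle_def)
qed

section \<open>The star of a vertex and the polygon of inverted neighbours\<close>

lemma affine_hull_eq_plane:
  fixes p q r a :: "real^3"
  assumes nc: "\<not> collinear {p, q, r}" and "a \<noteq> 0" "a \<bullet> (q - p) = 0" "a \<bullet> (r - p) = 0"
  shows "affine hull {p, q, r} = {x. a \<bullet> x = a \<bullet> p}"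
proof (rule affine_dim_equal)
  have ind: "\<not> affine_dependent {p, q, r}" and "p \<noteq> q" "p \<noteq> r" "q \<noteq> r"
    using nc collinear_3_eq_affine_dependent[of p q r] by auto
  then have "card {p, q, r} = 3"
    by simp
  then show "aff_dim (affine hull {p, q, r}) = aff_dim {x. a \<bullet> x = a \<bullet> p}"
    using aff_dim_affine_independent[OF ind] \<open>a \<noteq> 0\<close> by simp
  show "affine hull {p, q, r} \<subseteq> {x. a \<bullet> x = a \<bullet> p}"
    by (rule hull_minimal) (use assms in \<open>auto simp: inner_diff_right affine_hyperplane\<close>)
qed (auto simp: affine_hyperplane)

lemma convex_hull_3_memI:
  assumes "0 \<le> s" "0 \<le> t" "s + t \<le> 1"
  shows "p + s *\<^sub>R (q - p) + t *\<^sub>R (r - p) \<in> convex hull {p, q, r}"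
  unfolding convex_hull_3 using assms
  by (intro CollectI exI[of _ "1 - s - t"] exI[of _ s] exI[of _ t]) (simp add: algebra_simps)

locale vertex_star =
  fixes F :: "(real^3) set set" and v :: "real^3" and n :: nat and u :: "nat \<Rightarrow> real^3"
  assumes surface: "simplicial_surface F"
    and three_le_n: "3 \<le> n"
    and u_eq_iff: "u i = u j \<longleftrightarrow> i mod n = j mod n"
    and u_neq_v: "u i \<noteq> v"
    and star_eq: "star F v = range (\<lambda>i. {v, u i, u (Suc i)})"
begin

definition w :: "nat \<Rightarrow> real^3" where
  "w i = inversion (u i - v)"

lemma face: "{v, u i, u (Suc i)} \<in> F"
  using star_eq by (auto simp: star_def)

lemma face_at_v: "f \<in> F \<Longrightarrow> v \<in> f \<Longrightarrow> \<exists>i. f = {v, u i, u (Suc i)}"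
  using star_eq by (auto simp: star_def)

lemma u_Suc_neq: "u (Suc i) \<noteq> u i" "u (Suc (Suc i)) \<noteq> u i"
  using three_le_n by (auto simp: u_eq_iff mod_Suc split: if_splits)

lemma u_Suc_eq_iff: "u (Suc i) = u (Suc j) \<longleftrightarrow> u i = u j"
proof
  assume "u (Suc i) = u (Suc j)"
  then have "[i + 1 = j + 1] (mod n)"
    by (simp add: u_eq_iff cong_def)
  then show "u i = u j"
    unfolding cong_add_rcancel_nat by (simp add: u_eq_iff cong_def)
next
  assume "u i = u j"
  then show "u (Suc i) = u (Suc j)"
    unfolding u_eq_iff by (metis mod_Suc_eq)
qed

lemma not_collinear: "\<not> collinear {v, u i, u (Suc i)}"
proof -
  have "\<not> affine_dependent {v, u i, u (Suc i)}"
    using surface face unfolding simplicial_surface_def by blast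
  then show ?thesis
    using collinear_3_eq_affine_dependent[of v "u i" "u (Suc i)"] u_neq_v[of i] u_neq_v[of "Suc i"]
      u_Suc_neq(1)[of i] by auto
qed

lemma not_collinear': "\<not> collinear {v, u (Suc i), u i}"
  using not_collinear[of i] by (simp add: insert_commute)

lemma scaleR_w: "((u i - v) \<bullet> (u i - v)) *\<^sub>R w i = u i - v"
  by (simp add: w_def scaleR_inversion)

lemma inner_w: "c \<bullet> (u i - v) = ((u i - v) \<bullet> (u i - v)) * (c \<bullet> w i)"
  using arg_cong[OF scaleR_w[of i], of "inner c"] by simp

lemma norm_u_pos: "0 < (u i - v) \<bullet> (u i - v)"
  using u_neq_v[of i] by simp

text \<open>A convex combination of \<open>w i\<close> and \<open>w (i + 1)\<close> points in a direction inside the triangle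
  \<open>v, u i, u (i + 1)\<close>, so that triangle meets the triangle \<open>v, u k, u (k + 1)\<close> along its edge.\<close>

lemma vertex_on_edge:
  assumes k: "w k \<in> closed_segment (w i) (w (Suc i))"
  shows "w k = w i \<or> w k = w (Suc i)"
proof (rule ccontr)
  assume neq: "\<not> (w k = w i \<or> w k = w (Suc i))"
  then have "u k \<noteq> u i" "u k \<noteq> u (Suc i)"
    by (auto simp: w_def)
  obtain t where t: "0 \<le> t" "t \<le> 1" and wk: "w k = (1 - t) *\<^sub>R w i + t *\<^sub>R w (Suc i)"
    using k by (auto simp: in_segment)
  define r where "r i = (u i - v) \<bullet> (u i - v)" for i
  have r: "r i > 0" "w i = (1 / r i) *\<^sub>R (u i - v)" for i
    using norm_u_pos by (simp_all add: r_def w_def inversion_def)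
  \<comment> \<open>The coefficients of the combination after undoing the inversion at each of the
    three points.\<close>
  define \<alpha> \<gamma> where "\<alpha> = r k * (1 - t) / r i" and "\<gamma> = r k * t / r (Suc i)"
  have nonneg: "\<alpha> \<ge> 0" "\<gamma> \<ge> 0"
    using t r(1)[of i] r(1)[of "Suc i"] r(1)[of k] by (simp_all add: \<alpha>_def \<gamma>_def)
  have "u k - v = r k *\<^sub>R w k"
    by (simp add: r_def scaleR_w)
  also have "\<dots> = \<alpha> *\<^sub>R (u i - v) + \<gamma> *\<^sub>R (u (Suc i) - v)"
    unfolding wk r(2)[of i] r(2)[of "Suc i"] \<alpha>_def \<gamma>_def by (simp add: scaleR_add_right)
  finally have uk: "u k - v = \<alpha> *\<^sub>R (u i - v) + \<gamma> *\<^sub>R (u (Suc i) - v)" .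
  define \<epsilon> where "\<epsilon> = 1 / (1 + \<alpha> + \<gamma>)"
  have \<epsilon>: "\<epsilon> > 0" "\<epsilon> \<le> 1" "\<epsilon> * \<alpha> + \<epsilon> * \<gamma> \<le> 1"
    using nonneg by (simp_all add: \<epsilon>_def add_divide_distrib[symmetric])
  define z where "z = v + \<epsilon> *\<^sub>R (u k - v)"
  have "z = v + (\<epsilon> * \<alpha>) *\<^sub>R (u i - v) + (\<epsilon> * \<gamma>) *\<^sub>R (u (Suc i) - v)"
    unfolding z_def uk by (simp add: scaleR_add_right)
  then have "z \<in> convex hull {v, u i, u (Suc i)}"
    using convex_hull_3_memI[of "\<epsilon> * \<alpha>" "\<epsilon> * \<gamma>" v "u i" "u (Suc i)"] nonneg \<epsilon> by simp
  moreover have "z \<in> convex hull {v, u k, u (Suc k)}"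
    using convex_hull_3_memI[of \<epsilon> 0 v "u k" "u (Suc k)"] \<epsilon> by (simp add: z_def)
  ultimately have "z \<in> convex hull ({v, u i, u (Suc i)} \<inter> {v, u k, u (Suc k)})"
    using surface face[of i] face[of k] unfolding simplicial_surface_def by blast
  also have "\<dots> \<subseteq> convex hull {v, u (Suc k)}"
    by (rule hull_mono) (use \<open>u k \<noteq> u i\<close> \<open>u k \<noteq> u (Suc i)\<close> in auto)
  \<comment> \<open>\<open>z\<close> lies on the edge from \<open>v\<close> to \<open>u k\<close>,
    but the intersection of the two triangles leaves only the edge towards \<open>u (Suc k)\<close>;
    the triangle containing both edges would be degenerate.\<close>
  finally have "z \<in> closed_segment v (u (Suc k))"
    by (simp add: segment_convex_hull)
  then obtain s where "z = (1 - s) *\<^sub>R v + s *\<^sub>R u (Suc k)"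
    by (auto simp: in_segment)
  then have "\<epsilon> *\<^sub>R (u k - v) = s *\<^sub>R (u (Suc k) - v)"
    unfolding z_def by (simp add: algebra_simps)
  then have "(1 / \<epsilon>) *\<^sub>R (\<epsilon> *\<^sub>R (u k - v)) = (1 / \<epsilon>) *\<^sub>R (s *\<^sub>R (u (Suc k) - v))"
    by (simp only:)
  then have "u k - v = (s / \<epsilon>) *\<^sub>R (u (Suc k) - v)"
    using \<epsilon> by simp
  then have "collinear {0, u (Suc k) - v, u k - v}"
    unfolding collinear_lemma by blast
  then show False
    using not_collinear'[of k] collinear_3_diff[of v "u (Suc k)" "u k"] by blast
qed

sublocale simple_polygon n w
proof
  show "w (i + n) = w i" for i
    unfolding w_def inversion_inject using u_eq_iff[of "i + n" i] by simp
  show "w i = w j \<longleftrightarrow> i mod n = j mod n" for i j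
    unfolding w_def inversion_inject using u_eq_iff by simp
qed (rule three_le_n vertex_on_edge; assumption?)+

text \<open>The link being a cycle, exactly two faces contain this edge, with third vertices
  \<open>u i\<close> and \<open>u (Suc (Suc i))\<close>. Inversion turns their circumcircles into
  consecutive edge lines of \<open>w\<close>.\<close>

lemma beta_spoke: "beta F {v, u (Suc i)} = vec_angle (w (Suc i) - w i) (w (Suc (Suc i)) - w (Suc i))"
proof -
  have "beta F {v, u (Suc i)} = circle_angle v (u (Suc i)) (u i) (u (Suc (Suc i)))"
  proof (rule beta_eq_circle_angle)
    show "{v, u (Suc i), u i} \<in> F" "{v, u (Suc i), u (Suc (Suc i))} \<in> F"
      using face[of i] face[of "Suc i"] by (simp_all add: insert_commute)
    show "u i \<noteq> u (Suc (Suc i))"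
      using u_Suc_neq(2)[of i] by simp
    show "f = {v, u (Suc i), u i} \<or> f = {v, u (Suc i), u (Suc (Suc i))}"
      if f: "f \<in> F" "{v, u (Suc i)} \<subseteq> f" for f
    proof -
      obtain j where j: "f = {v, u j, u (Suc j)}"
        using face_at_v f by blast
      then consider "u (Suc i) = u j" | "u (Suc i) = u (Suc j)"
        using f(2) u_neq_v[of "Suc i"] by auto
      then show ?thesis
      proof cases
        case 1
        then show ?thesis
          using j u_Suc_eq_iff[of "Suc i" j] by simp
      next
        case 2
        then show ?thesis
          using j u_Suc_eq_iff[of i j] by (simp add: insert_commute)
      qed
    qed
    show "card f = 3" if "f \<in> F" for f
      using surface that unfolding simplicial_surface_def by blast
  qed (use not_collinear'[of i] not_collinear[of "Suc i"] in auto)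
  also have "\<dots> = vec_angle (w (Suc i) - w i) (w (Suc (Suc i)) - w (Suc i))"
    unfolding w_def by (rule circle_angle_inversion[OF not_collinear' not_collinear'])
  finally show ?thesis .
qed

lemma spokes: "{e \<in> edges F. v \<in> e} = (\<lambda>i. {v, u i}) ` {..<n}"
proof (intro equalityI subsetI)
  fix e
  assume "e \<in> {e \<in> edges F. v \<in> e}"
  then obtain f where f: "card e = 2" "f \<in> F" "e \<subseteq> f" "v \<in> e"
    by (auto simp: edges_def)
  then obtain x where x: "e = {v, x}" "x \<noteq> v"
    by (auto simp: card_2_iff)
  obtain j where "f = {v, u j, u (Suc j)}"
    using face_at_v f by blast
  then obtain i where "x = u i"
    using x f by auto
  also have "u i = u (i mod n)"
    by (simp add: u_eq_iff)
  finally show "e \<in> (\<lambda>i. {v, u i}) ` {..<n}"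
    using x n_pos by auto
next
  fix e
  assume "e \<in> (\<lambda>i. {v, u i}) ` {..<n}"
  then obtain i where "e = {v, u i}"
    by blast
  then show "e \<in> {e \<in> edges F. v \<in> e}"
    using u_neq_v[of i] face[of i] by (auto simp: edges_def card_2_iff)
qed

lemma willmore_eq: "willmore F v = total_curvature n w - 2 * pi"
proof -
  have "inj_on (\<lambda>i. {v, u i}) {..<n}"
    using u_neq_v by (auto simp: inj_on_def doubleton_eq_iff u_eq_iff)
  then have "(\<Sum>e\<in>{e \<in> edges F. v \<in> e}. beta F e) = (\<Sum>i<n. beta F {v, u i})"
    unfolding spokes by (simp add: sum.reindex)
  \<comment> \<open>The exterior angle with index \<open>i\<close> sits at \<open>w (Suc i)\<close>,
    hence the shift by one.\<close>
  also have "\<dots> = (\<Sum>i<n. beta F {v, u (i + 1)})"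
  proof (rule sum_periodic_shift[symmetric])
    show "beta F {v, u (i + n)} = beta F {v, u i}" for i
      using u_eq_iff[of "i + n" i] by simp
  qed
  also have "\<dots> = total_curvature n w"
    unfolding total_curvature_def by (simp add: beta_spoke)
  finally show ?thesis
    by (simp add: willmore_def)
qed

end

section \<open>Spheres and convexity of the star in terms of the polygon\<close>

context vertex_star
begin

lemma vertices_eq: "\<Union>(star F v) = insert v (range u)"
  unfolding star_eq by auto

text \<open>Inversion takes spheres through \<open>v\<close> to planes missing the origin, and
  planes through \<open>v\<close> to planes through the origin. A sphere with centre
  \<open>c\<close> gives the normal \<open>c - v\<close> at level 1 / 2; conversely a plane at level
  \<open>m\<close>, not 0, gives the centre \<open>v + N / (2 m)\<close>.\<close>

lemma cospherical_iff: "cospherical (\<Union>(star F v)) \<longleftrightarrow> (\<exists>N. N \<noteq> 0 \<and> (\<forall>k. N \<bullet> w k = N \<bullet> w 0))"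
proof
  assume "cospherical (\<Union>(star F v))"
  then obtain \<Sigma> where \<Sigma>: "moebius_sphere \<Sigma>" "insert v (range u) \<subseteq> \<Sigma>"
    unfolding cospherical_def vertices_eq by blast
  then have mem: "v \<in> \<Sigma>" "u k \<in> \<Sigma>" for k
    by auto
  from \<Sigma>(1) consider c \<rho> where "0 < \<rho>" "\<Sigma> = sphere c \<rho>" | a b where "a \<noteq> 0" "\<Sigma> = {x. a \<bullet> x = b}"
    unfolding moebius_sphere_def by blast
  then show "\<exists>N. N \<noteq> 0 \<and> (\<forall>k. N \<bullet> w k = N \<bullet> w 0)"
  proof cases
    case 1
    have "dist c v = \<rho>" "dist c (u k) = \<rho>" for k
      using mem(1) mem(2)[of k] 1(2) by simp_all
    then have "(u k - v) \<bullet> (u k - v) = 2 * ((c - v) \<bullet> (u k - v))" for k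
      using equidistant_iff[of c "u k" v] by simp
    then have "(c - v) \<bullet> w k = 1 / 2" for k
      using inner_w[of "c - v" k] norm_u_pos[of k] by (simp add: field_simps)
    moreover have "c - v \<noteq> 0"
      using \<open>dist c v = \<rho>\<close> \<open>0 < \<rho>\<close> by auto
    ultimately show ?thesis
      by metis
  next
    case 2
    have "a \<bullet> v = b" "a \<bullet> u k = b" for k
      using mem(1) mem(2)[of k] 2(2) by simp_all
    then have "a \<bullet> (u k - v) = 0" for k
      by (simp add: inner_diff_right)
    then have "a \<bullet> w k = 0" for k
      using inner_w[of a k] norm_u_pos[of k] by simp
    then show ?thesis
      using \<open>a \<noteq> 0\<close> by metis
  qed
next
  assume "\<exists>N. N \<noteq> 0 \<and> (\<forall>k. N \<bullet> w k = N \<bullet> w 0)"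
  then obtain N m where "N \<noteq> 0" and N: "\<And>k. N \<bullet> w k = m"
    by blast
  have uk: "N \<bullet> (u k - v) = m * ((u k - v) \<bullet> (u k - v))" for k
    using inner_w[of N k] N[of k] by simp
  show "cospherical (\<Union>(star F v))"
  proof (cases "m = 0")
    case True
    then have "insert v (range u) \<subseteq> {x. N \<bullet> x = N \<bullet> v}"
      using uk by (auto simp: inner_diff_right)
    then show ?thesis
      unfolding cospherical_def moebius_sphere_def vertices_eq using \<open>N \<noteq> 0\<close> by blast
  next
    case False
    define c where "c = v + (1 / (2 * m)) *\<^sub>R N"
    have "dist c (u k) = dist c v" for k
      unfolding equidistant_iff using uk[of k] False by (simp add: c_def)
    then have "insert v (range u) \<subseteq> sphere c (dist c v)"
      by auto
    moreover have "0 < dist c v"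
      using \<open>N \<noteq> 0\<close> False by (simp add: c_def)
    ultimately show ?thesis
      unfolding cospherical_def moebius_sphere_def vertices_eq by blast
  qed
qed

text \<open>Inversion rescales each \<open>u k - v\<close> by a positive factor, so the side of a
  plane through \<open>v\<close> is unchanged. Half-spaces are convex, so the vertices of the star
  decide.\<close>

lemma one_side_of_plane_iff:
  "one_side_of_plane {v, u i, u (Suc i)} (\<Union>g\<in>star F v. convex hull g) \<longleftrightarrow>
    (\<exists>a. a \<noteq> 0 \<and> a \<bullet> w i = 0 \<and> a \<bullet> w (Suc i) = 0 \<and> (\<forall>k. a \<bullet> w k \<le> 0))"
proof -
  have w0: "a \<bullet> w k = 0 \<longleftrightarrow> a \<bullet> u k = a \<bullet> v" and wle: "a \<bullet> w k \<le> 0 \<longleftrightarrow> a \<bullet> u k \<le> a \<bullet> v" for a k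
    using inner_w[of a k] norm_u_pos[of k] by (auto simp: inner_diff_right mult_le_0_iff zero_less_mult_iff)
       (smt (verit) mult_nonneg_nonpos mult_pos_pos)+
  have hulls: "(\<Union>g\<in>star F v. convex hull g) \<subseteq> {x. a \<bullet> x \<le> b} \<longleftrightarrow> a \<bullet> v \<le> b \<and> (\<forall>k. a \<bullet> u k \<le> b)"
    for a :: "real^3" and b
  proof -
    have "(\<Union>g\<in>star F v. convex hull g) \<subseteq> {x. a \<bullet> x \<le> b} \<longleftrightarrow> (\<forall>g\<in>star F v. g \<subseteq> {x. a \<bullet> x \<le> b})"
      unfolding UN_subset_iff subset_hull[of convex, OF convex_halfspace_le] by simp
    also have "\<dots> \<longleftrightarrow> \<Union>(star F v) \<subseteq> {x. a \<bullet> x \<le> b}"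
      by blast
    finally show ?thesis
      unfolding vertices_eq by (auto simp: image_subset_iff)
  qed
  show ?thesis
  proof
    assume "one_side_of_plane {v, u i, u (Suc i)} (\<Union>g\<in>star F v. convex hull g)"
    then obtain a b where ab: "a \<noteq> 0" "affine hull {v, u i, u (Suc i)} = {x. a \<bullet> x = b}"
      "(\<Union>g\<in>star F v. convex hull g) \<subseteq> {x. a \<bullet> x \<le> b}"
      unfolding one_side_of_plane_def by blast
    have "{v, u i, u (Suc i)} \<subseteq> {x. a \<bullet> x = b}"
      using ab(2) hull_subset by metis
    then have "a \<bullet> v = b" "a \<bullet> u i = b" "a \<bullet> u (Suc i) = b"
      by auto
    then show "\<exists>a. a \<noteq> 0 \<and> a \<bullet> w i = 0 \<and> a \<bullet> w (Suc i) = 0 \<and> (\<forall>k. a \<bullet> w k \<le> 0)"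
      using ab(1,3) hulls w0 wle by (intro exI[of _ a]) auto
  next
    assume "\<exists>a. a \<noteq> 0 \<and> a \<bullet> w i = 0 \<and> a \<bullet> w (Suc i) = 0 \<and> (\<forall>k. a \<bullet> w k \<le> 0)"
    then obtain a where a: "a \<noteq> 0" "a \<bullet> u i = a \<bullet> v" "a \<bullet> u (Suc i) = a \<bullet> v" "\<And>k. a \<bullet> u k \<le> a \<bullet> v"
      unfolding w0 wle by blast
    have "affine hull {v, u i, u (Suc i)} = {x. a \<bullet> x = a \<bullet> v}"
      using affine_hull_eq_plane[OF not_collinear a(1)] a(2,3) by (simp add: inner_diff_right)
    then show "one_side_of_plane {v, u i, u (Suc i)} (\<Union>g\<in>star F v. convex hull g)"
      unfolding one_side_of_plane_def using a(1,4) hulls[of a "a \<bullet> v"] by blast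
  qed
qed

text \<open>The sphere through \<open>v\<close> about the circumcentre of the face inverts to the
  plane \<open>c i \<bullet> x = 1 / 2\<close>, and its exterior to the side of smaller
  values.\<close>

lemma
  defines "c i \<equiv> circumcenter {v, u i, u (Suc i)} - v"
  shows inner_circumcenter_w: "c i \<bullet> w i = 1 / 2" "c i \<bullet> w (Suc i) = 1 / 2"
    and one_side_of_circumcircle_iff:
      "one_side_of_circumcircle {v, u i, u (Suc i)} (\<Union>(star F v)) \<longleftrightarrow>
        (\<forall>k. c i \<bullet> w k \<le> 1 / 2) \<or> (\<forall>k. 1 / 2 \<le> c i \<bullet> w k)"
proof -
  define C where "C = circumcenter {v, u i, u (Suc i)}"
  have Cc: "C - v = c i"
    by (simp add: C_def c_def)
  show "c i \<bullet> w i = 1 / 2" "c i \<bullet> w (Suc i) = 1 / 2"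
    using inner_circumcenter[OF not_collinear[of i], folded C_def] inner_w[of "c i" i] inner_w[of "c i" "Suc i"]
      norm_u_pos[of i] norm_u_pos[of "Suc i"] unfolding Cc by (simp_all add: field_simps)
  have dist_sq: "(dist C (u k))\<^sup>2 - (dist C v)\<^sup>2 = ((u k - v) \<bullet> (u k - v)) * (1 - 2 * (c i \<bullet> w k))" for k
  proof -
    have "(dist C (u k))\<^sup>2 = ((C - v) - (u k - v)) \<bullet> ((C - v) - (u k - v))"
      unfolding dist_norm power2_norm_eq_inner by simp
    also have "\<dots> = (C - v) \<bullet> (C - v) - 2 * ((C - v) \<bullet> (u k - v)) + (u k - v) \<bullet> (u k - v)"
      unfolding inner_diff_left[of "C - v" "u k - v"] inner_diff_right[of _ "C - v" "u k - v"]
        inner_commute[of "u k - v" "C - v"] by simp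
    also have "(C - v) \<bullet> (C - v) = (dist C v)\<^sup>2"
      by (simp only: dist_norm power2_norm_eq_inner)
    finally show ?thesis
      unfolding Cc inner_w[of "c i" k] by (simp add: right_diff_distrib mult.left_commute)
  qed
  have le1: "dist C v \<le> dist C (u k) \<longleftrightarrow> c i \<bullet> w k \<le> 1 / 2" for k
  proof -
    have "dist C v \<le> dist C (u k) \<longleftrightarrow> 0 \<le> (dist C (u k))\<^sup>2 - (dist C v)\<^sup>2"
      using abs_le_square_iff[of "dist C v" "dist C (u k)"] by simp
    then show ?thesis
      unfolding dist_sq using norm_u_pos[of k] by (auto simp: zero_le_mult_iff)
  qed
  have le2: "dist C (u k) \<le> dist C v \<longleftrightarrow> 1 / 2 \<le> c i \<bullet> w k" for k
  proof -
    have "dist C (u k) \<le> dist C v \<longleftrightarrow> (dist C (u k))\<^sup>2 - (dist C v)\<^sup>2 \<le> 0"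
      using abs_le_square_iff[of "dist C (u k)" "dist C v"] by simp
    then show ?thesis
      unfolding dist_sq using norm_u_pos[of k] by (auto simp: mult_le_0_iff)
  qed
  show "one_side_of_circumcircle {v, u i, u (Suc i)} (\<Union>(star F v)) \<longleftrightarrow>
      (\<forall>k. c i \<bullet> w k \<le> 1 / 2) \<or> (\<forall>k. 1 / 2 \<le> c i \<bullet> w k)"
    unfolding one_side_of_circumcircle_def vertices_eq circumradius_eq[OF not_collinear] C_def[symmetric]
    by (simp add: le1 le2)
qed

lemma cross_w_nonzero: "cross3 (w i) (w (Suc i)) \<noteq> 0"
proof
  define r s where "r = (u i - v) \<bullet> (u i - v)" and "s = (u (Suc i) - v) \<bullet> (u (Suc i) - v)"
  assume "cross3 (w i) (w (Suc i)) = 0"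
  then have "cross3 (r *\<^sub>R w i) (s *\<^sub>R w (Suc i)) = 0"
    by (simp add: cross_mult_left cross_mult_right)
  then have "cross3 (u i - v) (u (Suc i) - v) = 0"
    by (simp only: r_def s_def scaleR_w)
  then have "collinear {v, u i, u (Suc i)}"
    by (simp only: collinear_3_diff[of v] cross_eq_0)
  then show False
    using not_collinear by blast
qed

theorem energy_zero_imp_convex:
  assumes "willmore F v = 0"
  shows "star_convex F v \<and> cospherical (\<Union>(star F v))"
proof -
  have "total_curvature n w = 2 * pi"
    using assms by (simp add: willmore_eq)
  then obtain N where N: "N \<noteq> 0" "\<And>k. N \<bullet> w k = N \<bullet> w 0" and supp: "\<And>i. supporting_line N i"
    by (rule total_curvature_2pi_imp_convex) blast
  have plane: "one_side_of_plane {v, u i, u (Suc i)} (\<Union>g\<in>star F v. convex hull g)" for i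
  proof -
    \<comment> \<open>The normal of the face plane vanishes at both ends of edge \<open>i\<close>,
      so the supporting line keeps \<open>w\<close> on one side of that plane.\<close>
    define a where "a = cross3 (w i) (w (Suc i))"
    have a: "a \<noteq> 0" "a \<bullet> w i = 0" "a \<bullet> w (Suc i) = 0"
      using cross_w_nonzero by (simp_all add: a_def dot_cross_self)
    then have "(\<forall>k. a \<bullet> w k \<le> 0) \<or> (\<forall>k. (- a) \<bullet> w k \<le> 0)"
      using supporting_line_imp_one_side[OF N _ supp, of a i] by (simp add: inner_diff_right)
    then show ?thesis
      unfolding one_side_of_plane_iff using a by (metis inner_minus_left neg_equal_0_iff_equal)
  qed
  have circle: "one_side_of_circumcircle {v, u i, u (Suc i)} (\<Union>(star F v))" for i
    unfolding one_side_of_circumcircle_iff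
    using supporting_line_imp_one_side[OF N _ supp, of "circumcenter {v, u i, u (Suc i)} - v" i]
    by (simp only: inner_circumcenter_w inner_diff_right)
  have "star_convex F v"
    unfolding star_convex_def using plane circle star_eq by auto
  moreover have "cospherical (\<Union>(star F v))"
    unfolding cospherical_iff using N by blast
  ultimately show ?thesis
    by blast
qed

text \<open>Each face must supply a functional that is not constant on a plane containing
  \<open>w\<close>. If this plane avoids the origin, the face normal serves; if it contains the
  origin, the star is flat and the vector from \<open>v\<close> to the circumcentre takes
  over.\<close>

theorem convex_imp_energy_zero:
  assumes convex: "star_convex F v" and "cospherical (\<Union>(star F v))"
  shows "willmore F v = 0"
proof -
  obtain N where N: "N \<noteq> 0" "\<And>k. N \<bullet> w k = N \<bullet> w 0"
    using assms(2) unfolding cospherical_iff by blast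
  have "supporting_line N i" for i
  proof (cases "N \<bullet> w 0 = 0")
    case True
    have "N \<bullet> u k = N \<bullet> v" for k
      using inner_w[of N k] N(2)[of k] True by (simp add: inner_diff_right)
    moreover from this have "affine hull {v, u 0, u 1} = {x. N \<bullet> x = N \<bullet> v}"
      using affine_hull_eq_plane[OF not_collinear N(1), of 0] by (simp add: inner_diff_right)
    ultimately have "coplanar (\<Union>(star F v))"
      unfolding coplanar_def vertices_eq
      by (intro exI[of _ v] exI[of _ "u 0"] exI[of _ "u 1"]) auto
    then have "one_side_of_circumcircle {v, u i, u (Suc i)} (\<Union>(star F v))"
      using convex star_eq unfolding star_convex_def by auto
    \<comment> \<open>The witness \<open>w i\<close> is orthogonal to \<open>N\<close> and has inner
      product 1 / 2 with the circumcentre vector.\<close>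
    then show ?thesis
      unfolding one_side_of_circumcircle_iff
      using one_side_imp_supporting_line[OF N, of "circumcenter {v, u i, u (Suc i)} - v" i "w i"] N(2)[of i] True
      by (simp only: inner_circumcenter_w inner_diff_right)
  next
    case False
    have "one_side_of_plane {v, u i, u (Suc i)} (\<Union>g\<in>star F v. convex hull g)"
      using convex star_eq unfolding star_convex_def by auto
    then obtain a where a: "a \<noteq> 0" "a \<bullet> w i = 0" "a \<bullet> w (Suc i) = 0" "\<And>k. a \<bullet> w k \<le> 0"
      unfolding one_side_of_plane_iff by blast
    text \<open>The projection of \<open>a\<close> along \<open>w i\<close> to the plane orthogonal to \<open>N\<close>.\<close>
    define x where "x = a - ((N \<bullet> a) / (N \<bullet> w 0)) *\<^sub>R w i"
    have "N \<bullet> x = 0" "a \<bullet> x = a \<bullet> a"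
      using False N(2)[of i] a(2) by (simp_all add: x_def inner_diff_right)
    then show ?thesis
      using one_side_imp_supporting_line[OF N, of a i x] a by (simp add: inner_diff_right)
  qed
  then have "total_curvature n w = 2 * pi"
    using N by (intro convex_imp_total_curvature_2pi)
  then show ?thesis
    by (simp add: willmore_eq)
qed

end

theorem proposition2p2:
  fixes F :: "(real^3) set set" and v :: "real^3"
  assumes "simplicial_surface F" and "v \<in> vertices F"
  shows "willmore F v \<ge> 0 \<and>
         (willmore F v = 0 \<longleftrightarrow> star_convex F v \<and> cospherical (\<Union>(star F v)))"
proof -
  have "cyclic_link F v"
    using assms by (simp add: simplicial_surface_def)
  then obtain n u where n: "3 \<le> n" and inj: "inj_on u {..<n}" and v: "v \<notin> u ` {..<n}"
    and star: "star F v = (\<lambda>i. {v, u i, u (Suc i mod n)}) ` {..<n}"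
    unfolding cyclic_link_def by blast
  \<comment> \<open>The cyclic link lists the neighbours for indices below \<open>n\<close>;
    reduction modulo \<open>n\<close> extends the list periodically.\<close>
  interpret vertex_star F v n "\<lambda>i. u (i mod n)"
  proof
    show "u (i mod n) = u (j mod n) \<longleftrightarrow> i mod n = j mod n" for i j
      using inj n by (auto simp: inj_on_def)
    show "u (i mod n) \<noteq> v" for i
      using v n by (metis image_eqI lessThan_iff mod_less_divisor zero_less_numeral less_le_trans)
    let ?f = "\<lambda>i. {v, u (i mod n), u (Suc i mod n)}"
    have "star F v = ?f ` {..<n}"
      unfolding star by (intro image_cong) auto
    also have "\<dots> = range ?f"
    proof (rule antisym[OF image_mono[OF subset_UNIV]], rule subsetI)
      fix f
      assume "f \<in> range ?f"
      then obtain i where "f = ?f i"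
        by blast
      also have "\<dots> = ?f (i mod n)"
        by (simp only: mod_Suc_eq mod_mod_trivial)
      finally show "f \<in> ?f ` {..<n}"
        using n by (intro image_eqI[of _ _ "i mod n"]) auto
    qed
    finally show "star F v = range ?f" .
  qed (use assms n in auto)
  show ?thesis
    using fenchel energy_zero_imp_convex convex_imp_energy_zero by (auto simp: willmore_eq)
qed

end
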